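(* Let $0<\delta<1$. Suppose that $D=\{(x_i,y_i)\}_{i=1}^m$ satisfies $y_i=f^*(x_i)$ for $i=1,\dots,m$, that $f^*$ is continuous and $f^*=\mathcal L_K^rh^*$ for some $h^*\in L^2_{\rho_X}$ and some $0<r<1/2$, and that $\Xi=\{x_i\}_{i=1}^m$ are drawn i.i.d. according to $\rho_X$. Then with confidence (probability) at least $1-\delta$, the kernel interpolant $f_D$ satisfies $$\|f^*-f_D\|_\rho\le C_3\log^6\frac{24}\delta\,\min_{\lambda>0}\Big\{\Big(1+\big(1+\lambda m(\sigma_{m,\mathbb K})^{-1}\big)(\mathcal A_{D,\lambda}+1)^{2r+2}\Big)\lambda^r+\Big(\big(1+\lambda m(\sigma_{m,\mathbb K})^{-1}\big)+\lambda^{r-1/2}\Big)(\mathcal A_{D,\lambda}+1)^2\sqrt\lambda\,\mathcal A_{D,\lambda}\Big\},$$ where $C_3$ is a constant depending only on $\kappa$, $\|h^*\|_\rho$, $\|f^*\|_\infty$ and $r$.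
   Context: Setting. $\mathcal X\subset\mathbb R^d$ is a compact domain with Lipschitz boundary; $K:\mathcal X\times\mathcal X\to\mathbb R$ is a continuous, symmetric, strictly positive-definite kernel; $K_x:=K(x,\cdot)$; $\kappa:=\sqrt{\sup_{x,x'\in\mathcal X}K(x,x')}$. $\rho_X$ is a probability measure on $\mathcal X$ and $\|\cdot\|_\rho$ is the norm of $L^2_{\rho_X}$; $\|\cdot\|_\infty$ is the sup norm on $\mathcal X$. $\mathcal L_K:L^2_{\rho_X}\to L^2_{\rho_X}$, $\mathcal L_Kf=\int_{\mathcal X}f(x)K_x\,d\rho_X$, with powers defined by spectral calculus. Data and interpolant. $D=\{(x_i,y_i)\}_{i=1}^m$, the $x_i\in\mathcal X$ being (almost surely) pairwise distinct; $y_D=(y_1,\dots,y_m)^T$; $\mathbb K=(K(x_i,x_j))_{i,j=1}^m$; $f_D=\sum_{i=1}^m a_iK_{x_i}$ with $(a_1,\dots,a_m)^T=\mathbb K^{-1}y_D$. Let $\sigma_{1,\mathbb K}\ge\dots\ge\sigma_{m,\mathbb K}>0$ be the eigenvalues of $\mathbb K$ and $$\mathcal A_{D,\lambda}:=\left(\frac1{m\lambda}+\frac1{\sqrt{m\lambda}}\right)\max\left\{1,\sqrt{\sum_{\ell=1}^m\frac{\sigma_{\ell,\mathbb K}}{\lambda m+\sigma_{\ell,\mathbb K}}}\right\}.$$ *)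

theory Defs
  imports
    "HOL-Probability.Probability"
    "Jordan_Normal_Form.Char_Poly"
    "Jordan_Normal_Form.Gauss_Jordan_Elimination"
begin

text \<open>
  Points of \<open>R^d\<close> are sequences \<open>nat \<Rightarrow> real\<close> vanishing from index \<open>d\<close> on, with the topology
  \<^const>\<open>Euclidean_space\<close> \<open>d\<close>.  Thus \<open>d\<close> is an ordinary natural number and one constant can be
  asserted to work for all dimensions at once.  The Gram matrices have the varying size
  \<open>m\<close>, hence the matrices with explicit dimensions of \<^theory>\<open>Jordan_Normal_Form.Matrix\<close>.
\<close>

type_synonym point = "nat \<Rightarrow> real"

text \<open>
  Near each boundary point the set is, after a rotation, the closed epigraph of a Lipschitz
  function.  The unit vector \<open>u\<close> is the direction of the last rotated coordinate axis, and the
  hyperplane orthogonal to \<open>u\<close> carries the remaining \<open>d - 1\<close> coordinates.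
\<close>

definition lipschitz_boundary :: "nat \<Rightarrow> point set \<Rightarrow> bool" where
  "lipschitz_boundary d X \<longleftrightarrow>
    (\<forall>p \<in> Euclidean_space d frontier_of X.
      \<exists>U u \<phi> L. openin (Euclidean_space d) U \<and> p \<in> U \<and>
        u \<in> topspace (Euclidean_space d) \<and> L2_set u {..<d} = 1 \<and>
        (\<forall>v \<in> topspace (Euclidean_space d). \<forall>w \<in> topspace (Euclidean_space d).
           (\<Sum>i<d. v i * u i) = 0 \<longrightarrow> (\<Sum>i<d. w i * u i) = 0 \<longrightarrow>
           \<bar>\<phi> v - \<phi> w\<bar> \<le> L * L2_set (\<lambda>i. v i - w i) {..<d}) \<and>
        X \<inter> U = {x \<in> U. \<phi> (\<lambda>i. x i - (\<Sum>j<d. x j * u j) * u i) \<le> (\<Sum>j<d. x j * u j)})"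

text \<open>A compact domain is the closure of a bounded, nonempty, connected open set.\<close>

definition compact_lipschitz_domain :: "nat \<Rightarrow> point set \<Rightarrow> bool" where
  "compact_lipschitz_domain d X \<longleftrightarrow>
    1 \<le> d \<and> compactin (Euclidean_space d) X \<and>
    Euclidean_space d interior_of X \<noteq> {} \<and>
    connectedin (Euclidean_space d) (Euclidean_space d interior_of X) \<and>
    X = Euclidean_space d closure_of (Euclidean_space d interior_of X) \<and>
    lipschitz_boundary d X"

definition strictly_pos_def_on :: "'a set \<Rightarrow> ('a \<Rightarrow> 'a \<Rightarrow> real) \<Rightarrow> bool" where
  "strictly_pos_def_on X K \<longleftrightarrow>
    (\<forall>S c. finite S \<longrightarrow> S \<subseteq> X \<longrightarrow> (\<exists>x\<in>S. c x \<noteq> 0) \<longrightarrow>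
       0 < (\<Sum>x\<in>S. \<Sum>y\<in>S. c x * c y * K x y))"

definition admissible_kernel :: "point set \<Rightarrow> (point \<Rightarrow> point \<Rightarrow> real) \<Rightarrow> bool" where
  "admissible_kernel X K \<longleftrightarrow>
    continuous_on (X \<times> X) (\<lambda>(x, y). K x y) \<and>
    (\<forall>x\<in>X. \<forall>y\<in>X. K x y = K y x) \<and>
    strictly_pos_def_on X K"

definition kappa :: "'a set \<Rightarrow> ('a \<Rightarrow> 'a \<Rightarrow> real) \<Rightarrow> real" where
  "kappa X K = sqrt (SUP p \<in> X \<times> X. K (fst p) (snd p))"

definition sup_norm_on :: "'a set \<Rightarrow> ('a \<Rightarrow> real) \<Rightarrow> real" where
  "sup_norm_on X f = (SUP x\<in>X. \<bar>f x\<bar>)"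

text \<open>
  Elements of \<open>L\<^sup>2\<close> are represented by square-integrable functions; equality of classes is
  equality almost everywhere.
\<close>

definition L2_space :: "'a measure \<Rightarrow> ('a \<Rightarrow> real) set" where
  "L2_space M = {f \<in> borel_measurable M. integrable M (\<lambda>x. (f x)\<^sup>2)}"

definition L2_inner :: "'a measure \<Rightarrow> ('a \<Rightarrow> real) \<Rightarrow> ('a \<Rightarrow> real) \<Rightarrow> real" where
  "L2_inner M f g = (\<integral>x. f x * g x \<partial>M)"

definition L2_norm :: "'a measure \<Rightarrow> ('a \<Rightarrow> real) \<Rightarrow> real" where
  "L2_norm M f = sqrt (L2_inner M f f)"

definition kernel_op :: "'a measure \<Rightarrow> ('a \<Rightarrow> 'a \<Rightarrow> real) \<Rightarrow> ('a \<Rightarrow> real) \<Rightarrow> 'a \<Rightarrow> real" where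
  "kernel_op M K f = (\<lambda>y. \<integral>x. f x * K x y \<partial>M)"

text \<open>
  Spectral decomposition of the compact, self-adjoint, positive operator \<^const>\<open>kernel_op\<close>:
  an orthonormal family of eigenfunctions for positive eigenvalues, indexed by a finite or
  infinite set \<open>N\<close>, whose orthogonal complement is the kernel of the operator.
\<close>

definition eigensystem ::
  "'a measure \<Rightarrow> ('a \<Rightarrow> 'a \<Rightarrow> real) \<Rightarrow> nat set \<Rightarrow> (nat \<Rightarrow> real) \<Rightarrow> (nat \<Rightarrow> 'a \<Rightarrow> real) \<Rightarrow> bool" where
  "eigensystem M K N \<mu> e \<longleftrightarrow>
    (\<forall>i\<in>N. e i \<in> L2_space M) \<and>
    (\<forall>i\<in>N. \<forall>j\<in>N. L2_inner M (e i) (e j) = (if i = j then 1 else 0)) \<and>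
    (\<forall>i\<in>N. 0 < \<mu> i \<and> (AE x in M. kernel_op M K (e i) x = \<mu> i * e i x)) \<and>
    (\<forall>g\<in>L2_space M. (\<forall>i\<in>N. L2_inner M g (e i) = 0) \<longrightarrow> (AE x in M. kernel_op M K g x = 0))"

text \<open>
  \<open>f = L_K^r h\<close> in \<open>L\<^sup>2\<close>, for \<open>r > 0\<close>: the spectral sum
  \<open>\<Sum>i. \<mu>_i^r \<langle>h, e_i\<rangle> e_i\<close> converges to \<open>f\<close> in \<open>L\<^sup>2\<close>.  An eigensystem exists by the spectral
  theorem and the sum does not depend on which one is used.  The null space of \<open>L_K\<close> does not
  contribute because \<open>0^r = 0\<close>.
\<close>

definition is_kernel_op_power ::
  "'a measure \<Rightarrow> ('a \<Rightarrow> 'a \<Rightarrow> real) \<Rightarrow> real \<Rightarrow> ('a \<Rightarrow> real) \<Rightarrow> ('a \<Rightarrow> real) \<Rightarrow> bool" where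
  "is_kernel_op_power M K r h f \<longleftrightarrow>
    h \<in> L2_space M \<and> f \<in> L2_space M \<and>
    (\<exists>N \<mu> e. eigensystem M K N \<mu> e \<and>
      (\<lambda>n. L2_norm M (\<lambda>x. f x - (\<Sum>i\<in>N \<inter> {..<n}. \<mu> i powr r * L2_inner M h (e i) * e i x)))
        \<longlonglongrightarrow> 0)"

definition gram :: "('a \<Rightarrow> 'a \<Rightarrow> real) \<Rightarrow> nat \<Rightarrow> (nat \<Rightarrow> 'a) \<Rightarrow> real Matrix.mat" where
  "gram K m xs = Matrix.mat m m (\<lambda>(i, j). K (xs i) (xs j))"

text \<open>
  Indices run through \<open>0, \<dots>, m - 1\<close>, so \<open>gram_eig K m xs (m - 1)\<close> is the smallest eigenvalue
  \<open>\<sigma>\<^sub>m\<close>.  Eigenvalues are counted with multiplicity, in decreasing order; there are \<open>m\<close> of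
  them since the matrix is real symmetric.
\<close>

definition gram_eig :: "('a \<Rightarrow> 'a \<Rightarrow> real) \<Rightarrow> nat \<Rightarrow> (nat \<Rightarrow> 'a) \<Rightarrow> nat \<Rightarrow> real" where
  "gram_eig K m xs l = rev (sorted_list_of_multiset (proots (char_poly (gram K m xs)))) ! l"

text \<open>
  The matrix is invertible whenever \<open>K\<close> is strictly positive definite and the points are distinct.
\<close>

definition interpolant ::
  "('a \<Rightarrow> 'a \<Rightarrow> real) \<Rightarrow> nat \<Rightarrow> (nat \<Rightarrow> 'a) \<Rightarrow> (nat \<Rightarrow> real) \<Rightarrow> 'a \<Rightarrow> real" where
  "interpolant K m xs ys = (\<lambda>x.
     let a = the (mat_inverse (gram K m xs)) *\<^sub>v Matrix.vec m ys
     in \<Sum>i<m. vec_index a i * K (xs i) x)"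

definition A_quantity :: "('a \<Rightarrow> 'a \<Rightarrow> real) \<Rightarrow> nat \<Rightarrow> (nat \<Rightarrow> 'a) \<Rightarrow> real \<Rightarrow> real" where
  "A_quantity K m xs lam =
    (1 / (real m * lam) + 1 / sqrt (real m * lam)) *
    max 1 (sqrt (\<Sum>l<m. gram_eig K m xs l / (lam * real m + gram_eig K m xs l)))"

end

theory Submission
  imports Defs
begin

text \<open>
  Write \<open>\<sigma>\<close> for the smallest eigenvalue of the Gram matrix, \<open>H\<close> for the norm of \<open>h\<^sup>*\<close>, and \<open>B\<close> for the sup norm
  of \<open>f\<^sup>*\<close>.

  The bracket that is minimised over \<open>\<lambda>\<close> has a lower bound free of \<open>\<lambda>\<close>: for every \<open>\<lambda> > 0\<close> it is at least
  \<open>2 sqrt (m/\<sigma>) m\<^sup>-\<^sup>r\<close> (lemma \<open>error_bound_ge\<close>).  With \<open>t = \<lambda>m\<close> and \<open>A\<close> the quantity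
  \<open>A_quantity\<close>, the effective dimension is at least \<open>m\<sigma>/(t+\<sigma>)\<close>, whence \<open>A\<^sup>2 \<ge> m\<sigma>/(t(t+\<sigma>))\<close> and
  \<open>(1 + t/\<sigma>)(1 + A\<^sup>2) \<ge> t/\<sigma> + m/t \<ge> 2 sqrt (m/\<sigma>)\<close>; the remaining factor \<open>((A+1)\<^sup>2 \<lambda>)\<^sup>r\<close> is at
  least \<open>m\<^sup>-\<^sup>r\<close> because \<open>A \<ge> 1/sqrt (m\<lambda>)\<close>.  So it is enough to bound the error by a
  constant times \<open>log (24/\<delta>) sqrt (m/\<sigma>) m\<^sup>-\<^sup>r\<close>, in which \<open>\<lambda>\<close> no longer
  occurs.

  For that bound cut the spectral expansion of \<open>f\<^sup>*\<close> at the fixed level \<open>1/m\<close>.  The part \<open>g\<close> carried by the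
  eigenvalues \<open>\<ge> 1/m\<close> lies in the native space of \<open>K\<close>, with norm at most \<open>m\<^bsup>1/2-r\<^esup> H\<close>, and
  \<open>f\<^sup>* - g\<close> has \<open>L\<^sup>2\<close> norm of order \<open>m\<^sup>-\<^sup>r\<close> (lemma \<open>spectral_cutoff\<close>).  At any point \<open>t\<close> the
  interpolant is a fixed linear combination of the data, with weights \<open>b\<close> such that the Gram
  matrix maps \<open>b\<close> to the vector of the \<open>K(x\<^sub>i, t)\<close>.  Applied to \<open>g\<close>
  these weights err by at most \<open>\<kappa>\<close> times the native norm of \<open>g\<close>.  Applied to the data \<open>f\<^sup>* - g\<close> they give at
  most \<open>\<kappa>/sqrt \<sigma>\<close> times the Euclidean norm of the vector of values \<open>(f\<^sup>* - g)(x\<^sub>i)\<close> (lemma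
  \<open>interpolant_deviation\<close>).  An exponential moment bound for the i.i.d. sum of \<open>(f\<^sup>* - g)\<^sup>2(x\<^sub>i)\<close> shows that this vector
  has norm of order \<open>sqrt m m\<^sup>-\<^sup>r log (24/\<delta>)\<close> with probability at least \<open>1 - \<delta>\<close>
  (lemma \<open>empirical_sum_tail\<close>): its terms have mean of order \<open>m\<^bsup>-2r\<^esup>\<close>, and the pointwise bound
  \<open>|f\<^sup>* - g|\<^sup>2 = O (m\<^bsup>1-2r\<^esup>)\<close> is just small enough.  Finally \<open>\<sigma> \<le> \<kappa>\<^sup>2\<close> turns the terms
  \<open>m\<^bsup>1/2-r\<^esup>\<close> and \<open>m\<^sup>-\<^sup>r\<close> into multiples of \<open>sqrt (m/\<sigma>) m\<^sup>-\<^sup>r\<close>.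

  The native space enters only through one inequality, lemma \<open>kernel_op_Cauchy_Schwarz\<close>: positivity of the
  quadratic form of \<open>K\<close> at signed measures \<open>w\<rho> + \<nu>\<close> with \<open>\<nu>\<close> of finite support.
\<close>

section \<open>Symmetric forms and their smallest eigenvalue\<close>

lemma discriminant_nonpos:
  fixes a b d :: real
  assumes "\<And>s. 0 \<le> a + 2 * b * s + d * s\<^sup>2" and "0 \<le> d"
  shows "b\<^sup>2 \<le> a * d"
proof (cases "d = 0")
  case True
  have "b = 0"
  proof (rule ccontr)
    assume "b \<noteq> 0"
    then show False
      using assms(1)[of "- (a + 1) / (2 * b)"] True by simp
  qed
  with True show ?thesis by simp
next
  case False
  with assms(2) have "0 < d" by simp
  have "0 \<le> a - b\<^sup>2 / d"
    using assms(1)[of "- b / d"] \<open>0 < d\<close> by (simp add: field_simps power2_eq_square)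
  with \<open>0 < d\<close> show ?thesis by (simp add: field_simps)
qed

definition bform :: "(nat \<Rightarrow> nat \<Rightarrow> real) \<Rightarrow> nat \<Rightarrow> (nat \<Rightarrow> real) \<Rightarrow> (nat \<Rightarrow> real) \<Rightarrow> real" where
  "bform G n u v = (\<Sum>i<n. \<Sum>j<n. u i * v j * G i j)"

lemma bform_add_scaled:
  assumes "\<And>i j. i < n \<Longrightarrow> j < n \<Longrightarrow> G i j = G j i"
  shows "bform G n (\<lambda>i. u i + s * v i) (\<lambda>i. u i + s * v i) =
    bform G n u u + 2 * bform G n u v * s + bform G n v v * s\<^sup>2"
proof -
  have "bform G n v u = bform G n u v"
    unfolding bform_def
    by (subst sum.swap) (intro sum.cong refl, simp add: assms)
  moreover have "bform G n (\<lambda>i. u i + s * v i) (\<lambda>i. u i + s * v i) =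
    bform G n u u + s * bform G n u v + s * bform G n v u + s\<^sup>2 * bform G n v v"
    unfolding bform_def
    by (simp add: sum_distrib_left sum.distrib[symmetric] algebra_simps power2_eq_square)
  ultimately show ?thesis by (simp add: algebra_simps)
qed

lemma bform_Cauchy_Schwarz:
  assumes "\<And>i j. i < n \<Longrightarrow> j < n \<Longrightarrow> G i j = G j i"
    and "\<And>u. 0 \<le> bform G n u u"
  shows "(bform G n u v)\<^sup>2 \<le> bform G n u u * bform G n v v"
  by (intro discriminant_nonpos assms(2), subst bform_add_scaled[symmetric, OF assms(1)])
    (simp_all add: assms(2))

lemma bform_scale: "bform G n (\<lambda>i. s * u i) (\<lambda>i. s * u i) = s\<^sup>2 * bform G n u u"
  unfolding bform_def by (simp add: sum_distrib_left power2_eq_square mult_ac)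

text \<open>
  The form attains its minimum \<open>c\<close> on the unit sphere, which is compact.  The form minus \<open>c\<close> times the
  squared norm is then positive semidefinite and vanishes at the minimiser, so by Cauchy-Schwarz the minimiser is
  in its kernel, that is, it is an eigenvector.
\<close>
lemma min_eigenpair_exists:
  assumes sym: "\<And>i j. i < n \<Longrightarrow> j < n \<Longrightarrow> G i j = G j i" and "0 < n"
  shows "\<exists>c v. (\<exists>i<n. v i \<noteq> 0) \<and> (\<forall>i<n. (\<Sum>j<n. G i j * v j) = c * v i) \<and>
    (\<forall>u. c * (\<Sum>i<n. (u i)\<^sup>2) \<le> bform G n u u)"
proof -
  \<comment> \<open>The sphere of \<open>R^n\<close>, its vectors extended by 0; as a closed subset of a product of compact sets it is compact.\<close>
  define B :: "(nat \<Rightarrow> real) set" where "B = PiE UNIV (\<lambda>i. if i < n then {-1..1} else {0})"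
  define S where "S = B \<inter> {v. (\<Sum>i<n. (v i)\<^sup>2) = 1}"
  have "compactin (product_topology (\<lambda>_. euclidean) (UNIV :: nat set)) B"
    unfolding B_def compactin_PiE by (auto simp: compactin_euclidean_iff)
  then have "compact B"
    by (simp add: euclidean_product_topology compactin_euclidean_iff)
  moreover have "closed {v :: nat \<Rightarrow> real. (\<Sum>i<n. (v i)\<^sup>2) = 1}"
    by (intro closed_Collect_eq continuous_intros continuous_on_product_coordinates)
  ultimately have "compact S"
    unfolding S_def by (rule compact_Int_closed)
  have "(\<Sum>i<n. (if i = 0 then 1 else 0 :: real)\<^sup>2) = (\<Sum>i<n. if i = 0 then 1 else 0)"
    by (intro sum.cong) auto
  also have "\<dots> = 1"
    using \<open>0 < n\<close> by (subst sum.delta) auto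
  finally have "(\<lambda>i. if i = 0 then 1 else 0) \<in> S"
    using \<open>0 < n\<close> unfolding S_def B_def by auto
  then have "S \<noteq> {}" by blast
  have "continuous_on S (\<lambda>v. bform G n v v)"
    unfolding bform_def
    by (intro continuous_intros continuous_on_subset[OF continuous_on_product_coordinates]) auto
  from continuous_attains_inf[OF \<open>compact S\<close> \<open>S \<noteq> {}\<close> this]
  obtain v where v: "v \<in> S" and min: "\<And>u. u \<in> S \<Longrightarrow> bform G n v v \<le> bform G n u u"
    by blast
  define c where "c = bform G n v v"
  have v1: "(\<Sum>i<n. (v i)\<^sup>2) = 1" using v by (simp add: S_def)
  have ray: "c * (\<Sum>i<n. (u i)\<^sup>2) \<le> bform G n u u" for u
  proof (cases "(\<Sum>i<n. (u i)\<^sup>2) = 0")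
    case True
    then have "\<And>i. i < n \<Longrightarrow> u i = 0"
      by (subst (asm) sum_nonneg_eq_0_iff) auto
    with True show ?thesis by (simp add: bform_def)
  next
    case False
    define q where "q = (\<Sum>i<n. (u i)\<^sup>2)"
    have "0 < q" using False unfolding q_def by (simp add: order_less_le sum_nonneg)
    define w where "w = (\<lambda>i. if i < n then 1 / sqrt q * u i else 0)"
    have "(\<Sum>i<n. (w i)\<^sup>2) = (\<Sum>i<n. (u i)\<^sup>2 / q)"
      using \<open>0 < q\<close> unfolding w_def by (intro sum.cong) (auto simp: power_divide)
    then have w1: "(\<Sum>i<n. (w i)\<^sup>2) = 1"
      using \<open>0 < q\<close> by (simp add: sum_divide_distrib[symmetric] q_def)
    have "\<bar>w i\<bar> \<le> 1" if "i < n" for i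
    proof -
      have "(w i)\<^sup>2 \<le> (\<Sum>i<n. (w i)\<^sup>2)"
        using that by (intro member_le_sum) auto
      then show ?thesis by (simp add: w1 abs_square_le_1)
    qed
    then have "w \<in> S"
      unfolding S_def B_def using w1 by (auto simp: abs_le_iff) (simp_all add: w_def)
    then have "c \<le> bform G n w w" unfolding c_def by (rule min)
    also have "\<dots> = bform G n (\<lambda>i. 1 / sqrt q * u i) (\<lambda>i. 1 / sqrt q * u i)"
      unfolding bform_def w_def by (intro sum.cong) auto
    also have "\<dots> = bform G n u u / q"
      using \<open>0 < q\<close> unfolding bform_scale by (simp add: power_divide)
    finally show ?thesis
      using \<open>0 < q\<close> by (simp add: q_def[symmetric] field_simps)
  qed
  \<comment> \<open>\<open>G'\<close> is \<open>G\<close> minus \<open>c\<close> times the identity; it is tested against the unit vectors.\<close>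
  have eig: "(\<Sum>j<n. G i j * v j) = c * v i" if "i < n" for i
  proof -
    define G' where "G' = (\<lambda>i j. G i j - (if i = j then c else 0))"
    have G': "bform G' n u w = bform G n u w - c * (\<Sum>i<n. u i * w i)" for u w
    proof -
      have "bform G' n u w = (\<Sum>i<n. (\<Sum>j<n. u i * w j * G i j) -
          (\<Sum>j<n. if j = i then c * (u i * w i) else 0))"
        unfolding bform_def G'_def sum_subtractf[symmetric]
        by (intro sum.cong refl) (auto simp: algebra_simps)
      then show ?thesis
        by (simp add: bform_def sum_subtractf sum_distrib_left)
    qed
    have "0 \<le> bform G' n u u" for u
      using ray[of u] by (simp add: G' power2_eq_square)
    moreover have "G' i j = G' j i" if "i < n" "j < n" for i j
      using sym[OF that] by (simp add: G'_def)
    moreover have "bform G' n v v = 0"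
      using v1 by (simp add: G' c_def power2_eq_square)
    ultimately have "bform G' n (\<lambda>k. if k = i then 1 else 0) v = 0"
      using bform_Cauchy_Schwarz[of n G' "\<lambda>k. if k = i then 1 else 0" v] by simp
    moreover have "bform G n (\<lambda>k. if k = i then 1 else 0) v = (\<Sum>j<n. v j * G i j)"
    proof -
      have "bform G n (\<lambda>k. if k = i then 1 else 0) v =
          (\<Sum>k<n. if k = i then (\<Sum>j<n. v j * G i j) else 0)"
        unfolding bform_def by (intro sum.cong refl) auto
      then show ?thesis using that by simp
    qed
    moreover have "(\<Sum>k<n. (if k = i then 1 else 0) * v k) = (\<Sum>k<n. if k = i then v i else 0)"
      by (intro sum.cong) auto
    ultimately show ?thesis
      using that by (simp add: G' mult.commute)
  qed
  have "\<exists>i<n. v i \<noteq> 0"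
  proof (rule ccontr)
    assume "\<not> ?thesis"
    then have "(\<Sum>i<n. (v i)\<^sup>2) = 0" by simp
    with v1 show False by simp
  qed
  with eig ray show ?thesis by blast
qed

lemma eigenvalue_mat_iff:
  fixes G :: "nat \<Rightarrow> nat \<Rightarrow> 'a :: field"
  shows "eigenvalue (Matrix.mat n n (\<lambda>(i, j). G i j)) c \<longleftrightarrow>
    (\<exists>v. (\<exists>i<n. v i \<noteq> 0) \<and> (\<forall>i<n. (\<Sum>j<n. G i j * v j) = c * v i))"
    (is "eigenvalue ?A c \<longleftrightarrow> ?R")
proof
  assume "eigenvalue ?A c"
  then obtain v where v: "v \<in> carrier_vec n" "v \<noteq> 0\<^sub>v n" "?A *\<^sub>v v = c \<cdot>\<^sub>v v"
    unfolding eigenvalue_def eigenvector_def by auto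
  have "\<exists>i<n. v $ i \<noteq> 0"
    using v(1,2) by (auto simp: vec_eq_iff)
  moreover have "(\<Sum>j<n. G i j * v $ j) = c * v $ i" if "i < n" for i
    using arg_cong[OF v(3), of "\<lambda>x. x $ i"] that v(1)
    by (auto simp: scalar_prod_def atLeast0LessThan)
  ultimately show ?R by (intro exI[of _ "\<lambda>i. v $ i"]) auto
next
  assume ?R
  then obtain v where v: "\<exists>i<n. v i \<noteq> 0" "\<And>i. i < n \<Longrightarrow> (\<Sum>j<n. G i j * v j) = c * v i"
    by blast
  have "eigenvector ?A (Matrix.vec n v) c"
    unfolding eigenvector_def using v
    by (auto simp: vec_eq_iff scalar_prod_def atLeast0LessThan)
  then show "eigenvalue ?A c" unfolding eigenvalue_def by blast
qed

text \<open>
  Over the complex numbers the polynomial splits, and its roots are real: for an eigenvector \<open>v\<close> with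
  eigenvalue \<open>a\<close>, symmetry makes \<open>v\<^sup>*Gv = a |v|\<^sup>2\<close> invariant under conjugation.
\<close>
lemma symmetric_char_poly_splits:
  fixes G :: "nat \<Rightarrow> nat \<Rightarrow> real"
  assumes sym: "\<And>i j. i < n \<Longrightarrow> j < n \<Longrightarrow> G i j = G j i"
  obtains as where "char_poly (Matrix.mat n n (\<lambda>(i, j). G i j)) = (\<Prod>a\<leftarrow>as. [:- a, 1:])"
    and "length as = n"
proof -
  let ?A = "Matrix.mat n n (\<lambda>(i, j). G i j)"
  let ?C = "map_mat complex_of_real ?A"
  have C: "?C = Matrix.mat n n (\<lambda>(i, j). complex_of_real (G i j))"
    by (intro eq_matI) auto
  have carr: "?A \<in> carrier_mat n n" "?C \<in> carrier_mat n n" by auto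
  obtain as where as: "char_poly ?C = (\<Prod>a\<leftarrow>as. [:- a, 1:])" "length as = n"
    using char_poly_factorized[OF carr(2)] by blast
  have real: "complex_of_real (Re a) = a" if "a \<in> set as" for a
  proof -
    have "poly (char_poly ?C) a = 0"
      using that unfolding as(1) by (auto simp: poly_prod_list prod_list_zero_iff)
    then have "eigenvalue ?C a"
      using eigenvalue_root_char_poly[OF carr(2)] by blast
    then obtain v where v: "\<exists>i<n. v i \<noteq> 0"
      and ev: "\<And>i. i < n \<Longrightarrow> (\<Sum>j<n. complex_of_real (G i j) * v j) = a * v i"
      unfolding C eigenvalue_mat_iff by blast
    define q where "q = (\<Sum>i<n. \<Sum>j<n. cnj (v i) * (complex_of_real (G i j) * v j))"
    define N where "N = (\<Sum>i<n. (cmod (v i))\<^sup>2)"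
    have "cnj q = (\<Sum>i<n. \<Sum>j<n. v i * (complex_of_real (G i j) * cnj (v j)))"
      unfolding q_def by simp
    also have "\<dots> = q"
      unfolding q_def by (subst sum.swap) (intro sum.cong refl, simp add: sym mult_ac)
    finally have cq: "cnj q = q" .
    have "q = (\<Sum>i<n. cnj (v i) * (a * v i))"
      unfolding q_def by (intro sum.cong refl) (simp add: sum_distrib_left[symmetric] ev)
    also have "\<dots> = a * of_real N"
      unfolding N_def by (simp add: sum_distrib_left complex_norm_square mult_ac del: of_real_power)
    finally have q: "q = a * of_real N" .
    obtain i where "i < n" "v i \<noteq> 0" using v by blast
    then have "0 < (cmod (v i))\<^sup>2" by simp
    also have "\<dots> \<le> N" unfolding N_def
      using \<open>i < n\<close> by (intro member_le_sum) auto
    finally have "0 < N" .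
    then have "cnj a = a" using cq unfolding q by simp
    then show ?thesis by (metis Reals_cnj_iff of_real_Re)
  qed
  have hom_mult: "map_poly complex_of_real (p * q) = map_poly of_real p * map_poly of_real q" for p q
    by (simp add: poly_eq_iff coeff_map_poly coeff_mult)
  have "map_poly complex_of_real (char_poly ?A) = char_poly ?C"
    by (rule of_real_hom.char_poly_hom[OF carr(1), symmetric])
  also have "\<dots> = (\<Prod>a\<leftarrow>map Re as. [:- complex_of_real a, 1:])"
    unfolding as(1) using real by (simp add: o_def cong: map_cong)
  also have "\<dots> = map_poly complex_of_real (\<Prod>a\<leftarrow>map Re as. [:- a, 1:])"
    by (induction as) (simp_all add: hom_mult map_poly_pCons del: mult_pCons_left)
  finally have "char_poly ?A = (\<Prod>a\<leftarrow>map Re as. [:- a, 1:])"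
    by (simp add: poly_eq_iff coeff_map_poly)
  then show ?thesis using that as(2) by (metis length_map)
qed

text \<open>
  The list behind \<open>gram_eig\<close> is the sorted list of the roots of the characteristic polynomial.  As that
  polynomial splits, the list has length \<open>m\<close>, so its entry \<open>m - 1\<close> is really the least eigenvalue; it
  is bounded by the minimum of the Rayleigh quotient because that minimum is an eigenvalue.
\<close>
lemma gram_smallest_eig:
  assumes sym: "\<And>i j. i < m \<Longrightarrow> j < m \<Longrightarrow> K (xs i) (xs j) = K (xs j) (xs i)" and "0 < m"
  defines "G \<equiv> \<lambda>i j. K (xs i) (xs j)" and "\<sigma> \<equiv> gram_eig K m xs (m - 1)"
  shows "\<And>l. l < m \<Longrightarrow> \<sigma> \<le> gram_eig K m xs l"
    and "\<And>u. \<sigma> * (\<Sum>i<m. (u i)\<^sup>2) \<le> bform G m u u"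
    and "\<exists>v. (\<exists>i<m. v i \<noteq> 0) \<and> bform G m v v = \<sigma> * (\<Sum>i<m. (v i)\<^sup>2)"
proof -
  have symG: "\<And>i j. i < m \<Longrightarrow> j < m \<Longrightarrow> G i j = G j i"
    using sym by (simp add: G_def)
  have carr: "gram K m xs \<in> carrier_mat m m" by (simp add: gram_def)
  have gram: "gram K m xs = Matrix.mat m m (\<lambda>(i, j). G i j)" by (simp add: gram_def G_def)
  define p where "p = char_poly (gram K m xs)"
  define L where "L = sorted_list_of_multiset (proots p)"
  obtain as where as: "p = (\<Prod>a\<leftarrow>as. [:- a, 1:])" "length as = m"
    using symmetric_char_poly_splits[of m G] symG unfolding p_def gram by metis
  have "proots p = mset as"
    unfolding as(1) by (induction as)
      (simp_all add: proots_mult prod_list_zero_iff image_iff del: mult_pCons_left)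
  then have len: "length L = m"
    using as(2) unfolding L_def by (metis mset_sorted_list_of_multiset size_mset)
  have "p \<noteq> 0"
    using degree_monic_char_poly[OF carr] unfolding p_def by auto
  then have set_L: "set L = {c. eigenvalue (gram K m xs) c}"
    unfolding L_def using eigenvalue_root_char_poly[OF carr] by (simp add: p_def)
  have sorted: "sorted L" unfolding L_def by simp
  have eig: "gram_eig K m xs l = L ! (m - 1 - l)" if "l < m" for l
    using that len unfolding gram_eig_def p_def[symmetric] L_def[symmetric] by (simp add: rev_nth)
  have \<sigma>: "\<sigma> = L ! 0"
    using eig[of "m - 1"] \<open>0 < m\<close> by (simp add: \<sigma>_def)
  show "\<sigma> \<le> gram_eig K m xs l" if "l < m" for l
    unfolding \<sigma> eig[OF that] using sorted len that by (intro sorted_nth_mono) auto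
  obtain c v where c: "\<exists>i<m. v i \<noteq> 0" "\<And>i. i < m \<Longrightarrow> (\<Sum>j<m. G i j * v j) = c * v i"
    and ray: "\<And>u. c * (\<Sum>i<m. (u i)\<^sup>2) \<le> bform G m u u"
    using min_eigenpair_exists[of m G, OF symG \<open>0 < m\<close>] by blast
  have "c \<in> set L"
    unfolding set_L gram using c by (auto simp: eigenvalue_mat_iff)
  then have "\<sigma> \<le> c"
    unfolding \<sigma> using sorted by (metis in_set_conv_nth le0 sorted_nth_mono)
  then show "\<sigma> * (\<Sum>i<m. (u i)\<^sup>2) \<le> bform G m u u" for u
    using ray[of u] by (meson mult_right_mono order_trans sum_nonneg zero_le_power2)
  have "\<sigma> \<in> set L" using len \<open>0 < m\<close> unfolding \<sigma> by simp
  then obtain w where w: "\<exists>i<m. w i \<noteq> 0" "\<And>i. i < m \<Longrightarrow> (\<Sum>j<m. G i j * w j) = \<sigma> * w i"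
    unfolding set_L gram by (auto simp: eigenvalue_mat_iff)
  have "bform G m w w = (\<Sum>i<m. w i * (\<Sum>j<m. G i j * w j))"
    unfolding bform_def by (simp add: sum_distrib_left mult_ac)
  also have "\<dots> = \<sigma> * (\<Sum>i<m. (w i)\<^sup>2)"
    using w(2) by (simp add: sum_distrib_left power2_eq_square mult_ac)
  finally show "\<exists>v. (\<exists>i<m. v i \<noteq> 0) \<and> bform G m v v = \<sigma> * (\<Sum>i<m. (v i)\<^sup>2)"
    using w(1) by blast
qed

text \<open>
  Unfolds the matrix inverse once and for all: a positive definite matrix has a trivial kernel, hence is invertible.
\<close>
lemma interpolant_coeffs:
  assumes pd: "\<And>u. \<exists>i<m. u i \<noteq> 0 \<Longrightarrow> 0 < bform (\<lambda>i j. K (xs i) (xs j)) m u u"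
  shows "\<exists>a. (\<forall>t. interpolant K m xs y t = (\<Sum>i<m. a i * K (xs i) t)) \<and>
    (\<forall>i<m. (\<Sum>j<m. K (xs i) (xs j) * a j) = y i)"
proof -
  define A where "A = gram K m xs"
  have A: "A \<in> carrier_mat m m" by (simp add: A_def gram_def)
  have "Determinant.det A \<noteq> 0"
  proof
    assume "Determinant.det A = 0"
    then obtain v where v: "v \<in> carrier_vec m" "v \<noteq> 0\<^sub>v m" "A *\<^sub>v v = 0\<^sub>v m"
      using det_0_iff_vec_prod_zero[OF A] by blast
    have *: "(\<Sum>j<m. K (xs i) (xs j) * v $ j) = 0" if "i < m" for i
      using arg_cong[OF v(3), of "\<lambda>x. x $ i"] that v(1)
      by (auto simp: A_def gram_def scalar_prod_def atLeast0LessThan)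
    have "\<exists>i<m. v $ i \<noteq> 0" using v(1,2) by (auto simp: vec_eq_iff)
    then have "0 < bform (\<lambda>i j. K (xs i) (xs j)) m (($) v) (($) v)" by (rule pd)
    also have "\<dots> = (\<Sum>i<m. v $ i * (\<Sum>j<m. K (xs i) (xs j) * v $ j))"
      unfolding bform_def by (simp add: sum_distrib_left mult_ac)
    also have "\<dots> = 0" by (simp add: *)
    finally show False by simp
  qed
  then have "A \<in> Units (ring_mat TYPE(real) m ())"
    by (rule det_non_zero_imp_unit[OF A])
  then obtain B where inv: "mat_inverse A = Some B"
    using mat_inverse(1)[OF A] by fastforce
  have B: "A * B = 1\<^sub>m m" "B \<in> carrier_mat m m"
    using mat_inverse(2)[OF A inv] by auto
  define a where "a = B *\<^sub>v Matrix.vec m y"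
  have "a \<in> carrier_vec m" using B(2) by (simp add: a_def)
  have "A *\<^sub>v a = (A * B) *\<^sub>v Matrix.vec m y"
    unfolding a_def using A B(2) by (simp add: assoc_mult_mat_vec)
  then have Aa: "A *\<^sub>v a = Matrix.vec m y" by (simp add: B(1))
  have "(\<Sum>j<m. K (xs i) (xs j) * a $ j) = y i" if "i < m" for i
    using arg_cong[OF Aa, of "\<lambda>x. x $ i"] that \<open>a \<in> carrier_vec m\<close>
    by (auto simp: A_def gram_def scalar_prod_def atLeast0LessThan)
  moreover have "interpolant K m xs y t = (\<Sum>i<m. a $ i * K (xs i) t)" for t
    unfolding interpolant_def Let_def A_def[symmetric] inv a_def by simp
  ultimately show ?thesis by blast
qed

section \<open>Square-integrable functions\<close>

lemma L2_mult_integrable: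
  assumes "f \<in> L2_space M" "g \<in> L2_space M"
  shows "integrable M (\<lambda>x. f x * g x)"
proof (rule Bochner_Integration.integrable_bound)
  show "integrable M (\<lambda>x. (f x)\<^sup>2 + (g x)\<^sup>2)"
    using assms by (auto simp: L2_space_def)
  show "(\<lambda>x. f x * g x) \<in> borel_measurable M"
    using assms by (auto simp: L2_space_def)
  have "\<bar>a * b\<bar> \<le> a\<^sup>2 + b\<^sup>2" for a b :: real
    using sum_squares_bound[of "\<bar>a\<bar>" "\<bar>b\<bar>"] mult_nonneg_nonneg[of "\<bar>a\<bar>" "\<bar>b\<bar>"]
    unfolding abs_mult power2_abs by linarith
  then show "AE x in M. norm (f x * g x) \<le> norm ((f x)\<^sup>2 + (g x)\<^sup>2)"
    by simp
qed

lemma L2_add: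
  assumes "f \<in> L2_space M" "g \<in> L2_space M"
  shows "(\<lambda>x. f x + g x) \<in> L2_space M"
proof -
  have "integrable M (\<lambda>x. (f x)\<^sup>2 + (g x)\<^sup>2 + 2 * (f x * g x))"
    using assms L2_mult_integrable[OF assms] by (auto simp: L2_space_def)
  then show ?thesis
    using assms by (auto simp: L2_space_def power2_sum mult.assoc)
qed

lemma L2_scale: "f \<in> L2_space M \<Longrightarrow> (\<lambda>x. a * f x) \<in> L2_space M"
  by (auto simp: L2_space_def power_mult_distrib)

lemma L2_diff:
  assumes "f \<in> L2_space M" "g \<in> L2_space M"
  shows "(\<lambda>x. f x - g x) \<in> L2_space M"
  using L2_add[OF assms(1) L2_scale[OF assms(2), of "-1"]] by simp

lemma L2_sum:
  assumes "\<And>i. i \<in> F \<Longrightarrow> f i \<in> L2_space M"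
  shows "(\<lambda>x. \<Sum>i\<in>F. f i x) \<in> L2_space M"
  using assms
proof (induction F rule: infinite_finite_induct)
  case (insert i F)
  then show ?case using L2_add[of "f i" M "\<lambda>x. \<Sum>i\<in>F. f i x"] by simp
qed (simp_all add: L2_space_def)

lemma L2_inner_self: "L2_inner M f f = (\<integral>x. (f x)\<^sup>2 \<partial>M)"
  by (simp add: L2_inner_def power2_eq_square)

lemma L2_norm_sq: "(L2_norm M f)\<^sup>2 = (\<integral>x. (f x)\<^sup>2 \<partial>M)"
  unfolding L2_norm_def L2_inner_self by simp

lemma L2_inner_sum_right:
  assumes "g \<in> L2_space M" "\<And>i. i \<in> F \<Longrightarrow> f i \<in> L2_space M"
  shows "L2_inner M g (\<lambda>x. \<Sum>i\<in>F. a i * f i x) = (\<Sum>i\<in>F. a i * L2_inner M g (f i))"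
proof -
  have "L2_inner M g (\<lambda>x. \<Sum>i\<in>F. a i * f i x) = (\<integral>x. (\<Sum>i\<in>F. a i * (g x * f i x)) \<partial>M)"
    unfolding L2_inner_def by (simp add: sum_distrib_left mult_ac)
  also have "\<dots> = (\<Sum>i\<in>F. a i * L2_inner M g (f i))"
    unfolding L2_inner_def
    by (subst Bochner_Integration.integral_sum) (auto intro!: L2_mult_integrable assms)
  finally show ?thesis .
qed

lemma L2_inner_commute: "L2_inner M f g = L2_inner M g f"
  by (simp add: L2_inner_def mult.commute)

locale orthonormal_family =
  fixes M :: "'a measure" and F :: "nat set" and e :: "nat \<Rightarrow> 'a \<Rightarrow> real"
  assumes finite: "finite F"
    and L2: "\<And>i. i \<in> F \<Longrightarrow> e i \<in> L2_space M"
    and orthonormal: "\<And>i j. i \<in> F \<Longrightarrow> j \<in> F \<Longrightarrow> L2_inner M (e i) (e j) = (if i = j then 1 else 0)"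
begin

lemma inner_combination:
  "L2_inner M (\<lambda>x. \<Sum>i\<in>F. a i * e i x) (\<lambda>x. \<Sum>i\<in>F. b i * e i x) = (\<Sum>i\<in>F. a i * b i)"
proof -
  have "L2_inner M (\<lambda>x. \<Sum>i\<in>F. a i * e i x) (e j) = a j" if "j \<in> F" for j
  proof -
    have "L2_inner M (\<lambda>x. \<Sum>i\<in>F. a i * e i x) (e j) = (\<Sum>i\<in>F. if i = j then a j else 0)"
      using that by (subst L2_inner_commute, subst L2_inner_sum_right)
        (auto intro!: L2 sum.cong simp: orthonormal)
    then show ?thesis using that finite by simp
  qed
  then show ?thesis
    by (subst L2_inner_sum_right) (auto intro!: L2_sum L2_scale L2 sum.cong)
qed

lemma Bessel_inequality:
  assumes h: "h \<in> L2_space M"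
  shows "(\<Sum>i\<in>F. (L2_inner M h (e i))\<^sup>2) \<le> (L2_norm M h)\<^sup>2"
proof -
  define c where "c i = L2_inner M h (e i)" for i
  define s where "s = (\<lambda>x. \<Sum>i\<in>F. c i * e i x)"
  have s: "s \<in> L2_space M" unfolding s_def by (intro L2_sum L2_scale L2)
  have "0 \<le> (\<integral>x. (h x - s x)\<^sup>2 \<partial>M)" by simp
  also have "\<dots> = (\<integral>x. (h x)\<^sup>2 + (s x)\<^sup>2 - 2 * (h x * s x) \<partial>M)"
    by (simp add: power2_diff mult.assoc)
  also have "\<dots> = (L2_norm M h)\<^sup>2 + L2_inner M s s - 2 * L2_inner M h s"
    using h s L2_mult_integrable[OF h s]
    by (simp add: L2_space_def L2_norm_sq L2_inner_self) (simp add: L2_inner_def)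
  also have "L2_inner M s s = (\<Sum>i\<in>F. (c i)\<^sup>2)"
    unfolding s_def inner_combination by (simp add: power2_eq_square)
  also have "L2_inner M h s = (\<Sum>i\<in>F. (c i)\<^sup>2)"
    unfolding s_def by (subst L2_inner_sum_right) (auto simp: h L2 c_def power2_eq_square)
  finally show ?thesis by (simp add: c_def)
qed

end

section \<open>Kernels as positive forms on measures\<close>

text \<open>
  Positivity is stated for finite sequences of points with possible repetitions, so that a random point can be
  appended to a sequence whether or not it already occurs there.
\<close>
locale bounded_psd_kernel = prob_space M for M :: "'a measure" +
  fixes K :: "'a \<Rightarrow> 'a \<Rightarrow> real" and \<kappa> :: real
  assumes K_measurable [measurable]: "(\<lambda>(x, y). K x y) \<in> borel_measurable (M \<Otimes>\<^sub>M M)"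
    and K_sym: "\<And>x y. x \<in> space M \<Longrightarrow> y \<in> space M \<Longrightarrow> K x y = K y x"
    and K_diag: "\<And>x. x \<in> space M \<Longrightarrow> K x x \<le> \<kappa>\<^sup>2"
    and K_psd: "\<And>p n c. p ` {..<n} \<subseteq> space M \<Longrightarrow> 0 \<le> bform (\<lambda>i j. K (p i) (p j)) n c c"
    and \<kappa>_nonneg: "0 \<le> \<kappa>"
begin

lemma K_diag_nonneg: "x \<in> space M \<Longrightarrow> 0 \<le> K x x"
  using K_psd[of "\<lambda>_. x" 1 "\<lambda>_. 1"] by (auto simp: bform_def)

lemma K_bound:
  assumes "x \<in> space M" "y \<in> space M"
  shows "\<bar>K x y\<bar> \<le> \<kappa>\<^sup>2"
proof -
  define p where "p i = (if i = (0::nat) then x else y)" for i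
  have p: "p i \<in> space M" for i using assms by (simp add: p_def)
  have "(bform (\<lambda>i j. K (p i) (p j)) 2 (\<lambda>i. if i = 0 then 1 else 0) (\<lambda>i. if i = 0 then 0 else 1))\<^sup>2
      \<le> bform (\<lambda>i j. K (p i) (p j)) 2 (\<lambda>i. if i = 0 then 1 else 0) (\<lambda>i. if i = 0 then 1 else 0) *
        bform (\<lambda>i j. K (p i) (p j)) 2 (\<lambda>i. if i = 0 then 0 else 1) (\<lambda>i. if i = 0 then 0 else 1)"
    by (intro bform_Cauchy_Schwarz K_sym K_psd p) (use p in auto)
  then have "(K x y)\<^sup>2 \<le> K x x * K y y"
    by (simp add: bform_def numeral_2_eq_2 p_def)
  also have "\<dots> \<le> \<kappa>\<^sup>2 * \<kappa>\<^sup>2"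
    using assms by (intro mult_mono K_diag K_diag_nonneg) auto
  finally show ?thesis
    by (metis abs_le_square_iff abs_of_nonneg power2_eq_square zero_le_power2)
qed

lemma L2_integrable:
  assumes "w \<in> L2_space M"
  shows "integrable M w"
proof -
  have "(\<lambda>_. 1) \<in> L2_space M" by (simp add: L2_space_def)
  from L2_mult_integrable[OF assms this] show ?thesis by simp
qed

lemma integrable_mult_bounded:
  fixes w :: "'a \<Rightarrow> real"
  assumes "integrable M w" "f \<in> borel_measurable M" "\<And>x. x \<in> space M \<Longrightarrow> \<bar>f x\<bar> \<le> c"
  shows "integrable M (\<lambda>x. w x * f x)"
proof (rule Bochner_Integration.integrable_bound)
  show "integrable M (\<lambda>x. c * w x)" using assms(1) by simp
  show "(\<lambda>x. w x * f x) \<in> borel_measurable M" using assms(1,2) by simp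
  have "\<bar>w x\<bar> * \<bar>f x\<bar> \<le> \<bar>c\<bar> * \<bar>w x\<bar>" if "x \<in> space M" for x
    using assms(3)[OF that] by (subst mult.commute) (intro mult_right_mono, auto)
  then show "AE x in M. norm (w x * f x) \<le> norm (c * w x)"
    by (auto simp: abs_mult)
qed

lemma integrable_kernel_section:
  assumes "w \<in> L2_space M" "y \<in> space M"
  shows "integrable M (\<lambda>x. w x * K x y)"
proof (rule integrable_mult_bounded[OF L2_integrable[OF assms(1)]])
  show "(\<lambda>x. K x y) \<in> borel_measurable M"
    using measurable_Pair1[OF K_measurable assms(2)] by simp
qed (use K_bound assms(2) in auto)

lemma kernel_op_measurable:
  assumes "w \<in> L2_space M"
  shows "kernel_op M K w \<in> borel_measurable M"
proof -
  have [measurable]: "w \<in> borel_measurable M" using assms by (simp add: L2_space_def)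
  have "(\<lambda>(y, x). w x * K x y) \<in> borel_measurable (M \<Otimes>\<^sub>M M)"
    using measurable_pair_swap[OF K_measurable] by (simp add: case_prod_beta)
  then show ?thesis
    unfolding kernel_op_def by (rule borel_measurable_lebesgue_integral)
qed

lemma kernel_op_bound:
  assumes "w \<in> L2_space M" "y \<in> space M"
  shows "\<bar>kernel_op M K w y\<bar> \<le> (\<integral>x. \<bar>w x\<bar> * \<kappa>\<^sup>2 \<partial>M)"
proof -
  have "\<bar>kernel_op M K w y\<bar> \<le> (\<integral>x. \<bar>w x * K x y\<bar> \<partial>M)"
    unfolding kernel_op_def by (rule integral_abs_bound)
  also have "\<dots> \<le> (\<integral>x. \<bar>w x\<bar> * \<kappa>\<^sup>2 \<partial>M)"
  proof (rule integral_mono)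
    show "integrable M (\<lambda>x. \<bar>w x * K x y\<bar>)"
      using integrable_kernel_section[OF assms] by (rule integrable_abs)
    show "integrable M (\<lambda>x. \<bar>w x\<bar> * \<kappa>\<^sup>2)"
      using L2_integrable[OF assms(1)] by simp
    show "\<bar>w x * K x y\<bar> \<le> \<bar>w x\<bar> * \<kappa>\<^sup>2" if "x \<in> space M" for x
      unfolding abs_mult using that assms(2) by (intro mult_left_mono K_bound) auto
  qed
  finally show ?thesis .
qed

lemma kernel_op_L2:
  assumes "w \<in> L2_space M"
  shows "kernel_op M K w \<in> L2_space M"
proof -
  let ?g = "kernel_op M K w" and ?c = "\<integral>x. \<bar>w x\<bar> * \<kappa>\<^sup>2 \<partial>M"
  have m: "?g \<in> borel_measurable M" by (rule kernel_op_measurable[OF assms])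
  have "AE x in M. norm (?g x) \<le> ?c"
    using kernel_op_bound[OF assms] by auto
  then have i: "integrable M ?g" using m by (rule integrable_const_bound)
  have "integrable M (\<lambda>x. ?g x * ?g x)"
    by (rule integrable_mult_bounded[OF i m kernel_op_bound[OF assms]])
  then show ?thesis using m by (simp add: L2_space_def power2_eq_square)
qed

text \<open>
  The form of \<open>K\<close> is nonnegative at the discrete measure
  \<open>s \<Sum>\<^sub>j w(X\<^sub>j) \<delta>(X\<^sub>j) + \<Sum>\<^sub>i c\<^sub>i \<delta>(p\<^sub>i)\<close> for any points \<open>X\<^sub>1, \<dots>, X\<^sub>n\<close>.  Averaging over
  independent \<open>X\<^sub>j\<close> with law \<open>M\<close> gives the claim: the \<open>n(n-1)\<close> off-diagonal pairs contribute the
  integral form of \<open>w\<close> and the \<open>n\<close> diagonal ones the integral of \<open>w(x)\<^sup>2 K(x,x)\<close>.  The induction takes the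
  expectation one point at a time: the fresh point \<open>x\<close> joins the \<open>p\<^sub>i\<close> with weight \<open>s w(x)\<close>, and the
  statement for \<open>n\<close> is integrated over \<open>x\<close>.
\<close>
lemma mixed_quadratic_form_nonneg:
  assumes w: "w \<in> L2_space M" and p: "p ` {..<k} \<subseteq> space M"
  defines "g \<equiv> kernel_op M K w"
  shows "0 \<le> real n * (real n - 1) * s\<^sup>2 * L2_inner M w g + real n * s\<^sup>2 * (\<integral>x. (w x)\<^sup>2 * K x x \<partial>M)
    + 2 * real n * s * (\<Sum>i<k. c i * g (p i)) + bform (\<lambda>i j. K (p i) (p j)) k c c"
  using p
proof (induction n arbitrary: k p c)
  case 0
  then show ?case by (simp add: K_psd)
next
  case (Suc n)
  let ?W = "L2_inner M w g" and ?D = "\<integral>x. (w x)\<^sup>2 * K x x \<partial>M"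
  let ?C = "\<Sum>i<k. c i * g (p i)" and ?B = "bform (\<lambda>i j. K (p i) (p j)) k c c"
  define \<alpha> where "\<alpha> = real n * (real n - 1) * s\<^sup>2 * ?W + real n * s\<^sup>2 * ?D + 2 * real n * s * ?C + ?B"
  \<comment> \<open>The statement for \<open>n\<close> with the extra point \<open>x\<close> of weight \<open>s w(x)\<close>, sorted by its dependence on \<open>x\<close>.\<close>
  define f where "f x = \<alpha> + (2 * real n * s\<^sup>2) * (w x * g x)
    + (\<Sum>i<k. (2 * s * c i) * (w x * K x (p i))) + s\<^sup>2 * ((w x)\<^sup>2 * K x x)" for x
  have pk: "p i \<in> space M" if "i < k" for i using Suc.prems that by auto
  have "0 \<le> f x" if x: "x \<in> space M" for x
  proof -
    define p' where "p' = p(k := x)"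
    define c' where "c' = c(k := s * w x)"
    have "p' ` {..<Suc k} \<subseteq> space M"
      using x pk by (auto simp: p'_def less_Suc_eq)
    from Suc.IH[OF this, of c']
    have "0 \<le> real n * (real n - 1) * s\<^sup>2 * ?W + real n * s\<^sup>2 * ?D
      + 2 * real n * s * (\<Sum>i<Suc k. c' i * g (p' i)) + bform (\<lambda>i j. K (p' i) (p' j)) (Suc k) c' c'" .
    also have "(\<Sum>i<Suc k. c' i * g (p' i)) = ?C + s * w x * g x"
      by (simp add: c'_def p'_def)
    also have "bform (\<lambda>i j. K (p' i) (p' j)) (Suc k) c' c' =
        ?B + (\<Sum>i<k. c i * (s * w x) * K (p i) x) + ((\<Sum>j<k. s * w x * c j * K x (p j)) + (s * w x) * (s * w x) * K x x)"
      by (simp add: bform_def c'_def p'_def sum.distrib)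
    also have "(\<Sum>i<k. c i * (s * w x) * K (p i) x) = (\<Sum>j<k. s * w x * c j * K x (p j))"
      using x pk by (intro sum.cong) (auto simp: K_sym)
    also have "real n * (real n - 1) * s\<^sup>2 * ?W + real n * s\<^sup>2 * ?D + 2 * real n * s * (?C + s * w x * g x)
        + (?B + (\<Sum>j<k. s * w x * c j * K x (p j))
          + ((\<Sum>j<k. s * w x * c j * K x (p j)) + (s * w x) * (s * w x) * K x x)) = f x"
      unfolding f_def \<alpha>_def
      by (simp add: algebra_simps power2_eq_square sum_distrib_left sum.distrib[symmetric])
    finally show ?thesis .
  qed
  then have "0 \<le> (\<integral>x. f x \<partial>M)" by (intro integral_nonneg_AE) auto
  moreover have "(\<integral>x. f x \<partial>M) = \<alpha> + 2 * real n * s\<^sup>2 * ?W + 2 * s * ?C + s\<^sup>2 * ?D"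
  proof -
    have wg: "integrable M (\<lambda>x. w x * g x)"
      unfolding g_def by (intro L2_mult_integrable w kernel_op_L2)
    have wK: "integrable M (\<lambda>x. w x * K x (p i))" if "i < k" for i
      using integrable_kernel_section[OF w pk[OF that]] .
    have "(\<lambda>x. K x x) \<in> borel_measurable M"
      using measurable_compose[OF measurable_Pair[OF measurable_ident measurable_ident] K_measurable]
      by simp
    then have wD: "integrable M (\<lambda>x. (w x)\<^sup>2 * K x x)"
      using w K_bound by (intro integrable_mult_bounded[of _ _ "\<kappa>\<^sup>2"]) (auto simp: L2_space_def)
    have "(\<integral>x. f x \<partial>M) = \<alpha> + (2 * real n * s\<^sup>2) * (\<integral>x. w x * g x \<partial>M)
        + (\<Sum>i<k. (2 * s * c i) * (\<integral>x. w x * K x (p i) \<partial>M)) + s\<^sup>2 * ?D"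
    proof -
      have "integrable M (\<lambda>x. \<Sum>i<k. (2 * s * c i) * (w x * K x (p i)))"
        using wK by (intro Bochner_Integration.integrable_sum integrable_mult_right) auto
      moreover have "(\<integral>x. (\<Sum>i<k. (2 * s * c i) * (w x * K x (p i))) \<partial>M)
          = (\<Sum>i<k. (2 * s * c i) * (\<integral>x. w x * K x (p i) \<partial>M))"
        using wK by (subst Bochner_Integration.integral_sum) auto
      ultimately show ?thesis
        unfolding f_def using wg wD by (simp add: prob_space)
    qed
    also have "(\<integral>x. w x * g x \<partial>M) = ?W" by (simp add: L2_inner_def)
    also have "(\<Sum>i<k. (2 * s * c i) * (\<integral>x. w x * K x (p i) \<partial>M)) = 2 * s * ?C"
      by (simp add: g_def kernel_op_def sum_distrib_left mult_ac)
    finally show ?thesis .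
  qed
  ultimately show ?case unfolding \<alpha>_def by (simp add: algebra_simps)
qed

text \<open>
  Taking \<open>s/n\<close> for \<open>s\<close> in the averaged form and letting \<open>n\<close> tend to infinity removes the diagonal term.  What
  remains is the form of \<open>K\<close> at \<open>s w M + \<nu>\<close> with \<open>\<nu> = \<Sum>\<^sub>i c\<^sub>i \<delta>(p\<^sub>i)\<close>, a nonnegative quadratic
  polynomial in \<open>s\<close>, so its discriminant is not positive.  In terms of the native space: the image \<open>L w\<close> has squared norm
  \<open>\<langle>w, L w\<rangle>\<close>, and \<open>\<nu>\<close> acts on it as a functional whose squared norm is the form of \<open>K\<close> at \<open>\<nu>\<close>.
\<close>
lemma kernel_op_Cauchy_Schwarz:
  assumes w: "w \<in> L2_space M" and p: "p ` {..<k} \<subseteq> space M"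
  shows "(\<Sum>i<k. c i * kernel_op M K w (p i))\<^sup>2
    \<le> bform (\<lambda>i j. K (p i) (p j)) k c c * L2_inner M w (kernel_op M K w)"
    and "0 \<le> L2_inner M w (kernel_op M K w)"
proof -
  let ?g = "kernel_op M K w" and ?D = "\<integral>x. (w x)\<^sup>2 * K x x \<partial>M"
  let ?W = "L2_inner M w ?g"
  have limit: "0 \<le> bform (\<lambda>i j. K (q i) (q j)) l d d + 2 * (\<Sum>i<l. d i * ?g (q i)) * s + ?W * s\<^sup>2"
    if q: "q ` {..<l} \<subseteq> space M" for q l d s
  proof -
    let ?L = "bform (\<lambda>i j. K (q i) (q j)) l d d + 2 * (\<Sum>i<l. d i * ?g (q i)) * s + ?W * s\<^sup>2"
    have "(\<lambda>n. ?L + s\<^sup>2 * (?D - ?W) * (1 / real n)) \<longlonglongrightarrow> ?L + s\<^sup>2 * (?D - ?W) * 0"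
      by (intro tendsto_intros lim_1_over_n)
    moreover have "0 \<le> ?L + s\<^sup>2 * (?D - ?W) * (1 / real n)" if "1 \<le> n" for n
    proof -
      have "real n * (real n - 1) * (s / real n)\<^sup>2 = s\<^sup>2 - s\<^sup>2 * (1 / real n)"
        "real n * (s / real n)\<^sup>2 = s\<^sup>2 * (1 / real n)" "2 * real n * (s / real n) = 2 * s"
        using that by (simp_all add: field_simps power2_eq_square)
      with mixed_quadratic_form_nonneg[OF w q, of n "s / real n" d] show ?thesis
        by (simp only:) (simp add: algebra_simps)
    qed
    ultimately have "0 \<le> ?L + s\<^sup>2 * (?D - ?W) * 0"
      by (intro LIMSEQ_le_const) auto
    then show ?thesis by simp
  qed
  from limit[of "\<lambda>_. undefined" 0 "\<lambda>_. 0" 1] show W: "0 \<le> ?W" by (simp add: bform_def)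
  show "(\<Sum>i<k. c i * ?g (p i))\<^sup>2 \<le> bform (\<lambda>i j. K (p i) (p j)) k c c * ?W"
    by (rule discriminant_nonpos[OF limit[OF p] W])
qed

lemma kernel_op_pointwise_bound:
  assumes w: "w \<in> L2_space M" and t: "t \<in> space M"
  shows "\<bar>kernel_op M K w t\<bar> \<le> \<kappa> * sqrt (L2_inner M w (kernel_op M K w))"
proof -
  let ?W = "L2_inner M w (kernel_op M K w)"
  have "(kernel_op M K w t)\<^sup>2 \<le> K t t * ?W"
    using kernel_op_Cauchy_Schwarz(1)[OF w, of "\<lambda>_. t" 1 "\<lambda>_. 1"] t
    by (simp add: bform_def image_subset_iff)
  also have "\<dots> \<le> \<kappa>\<^sup>2 * ?W"
    using t kernel_op_Cauchy_Schwarz(2)[OF w, of "\<lambda>_. t" 0] by (intro mult_right_mono K_diag) auto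
  finally have "sqrt ((kernel_op M K w t)\<^sup>2) \<le> sqrt (\<kappa>\<^sup>2 * ?W)"
    by (rule real_sqrt_le_mono)
  then show ?thesis using \<kappa>_nonneg by (simp add: real_sqrt_mult)
qed

text \<open>
  The upper bound compares with the Rayleigh quotient at the first unit vector, a diagonal entry of the matrix.
\<close>
lemma smallest_eig_bounds:
  assumes xs: "xs ` {..<m} \<subseteq> space M" and "0 < m"
    and pd: "\<And>u. \<exists>i<m. u i \<noteq> 0 \<Longrightarrow> 0 < bform (\<lambda>i j. K (xs i) (xs j)) m u u"
  shows "0 < gram_eig K m xs (m - 1)" and "gram_eig K m xs (m - 1) \<le> \<kappa>\<^sup>2"
proof -
  let ?G = "\<lambda>i j. K (xs i) (xs j)" and ?\<sigma> = "gram_eig K m xs (m - 1)"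
  have X: "xs i \<in> space M" if "i < m" for i using xs that by auto
  have sym: "?G i j = ?G j i" if "i < m" "j < m" for i j using that by (intro K_sym X)
  note eig = gram_smallest_eig[of m K xs, OF sym \<open>0 < m\<close>]
  obtain v where v: "\<exists>i<m. v i \<noteq> 0" "bform ?G m v v = ?\<sigma> * (\<Sum>i<m. (v i)\<^sup>2)"
    using eig(3) by blast
  then have "0 < ?\<sigma> * (\<Sum>i<m. (v i)\<^sup>2)" using pd[OF v(1)] by simp
  moreover have "0 \<le> (\<Sum>i<m. (v i)\<^sup>2)" by (simp add: sum_nonneg)
  ultimately show "0 < ?\<sigma>" by (simp add: zero_less_mult_iff)
  define u where "u i = (if i = 0 then 1 else 0 :: real)" for i :: nat
  have "(\<Sum>i<m. (u i)\<^sup>2) = (\<Sum>i<m. if i = 0 then 1 else 0)"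
    by (intro sum.cong) (auto simp: u_def)
  moreover have "bform ?G m u u = (\<Sum>i<m. if i = 0 then K (xs 0) (xs 0) else 0)"
    unfolding bform_def
  proof (intro sum.cong refl)
    fix i assume "i \<in> {..<m}"
    have "(\<Sum>j<m. u i * u j * ?G i j) = (\<Sum>j<m. if j = 0 then u i * ?G i 0 else 0)"
      by (intro sum.cong) (auto simp: u_def)
    then show "(\<Sum>j<m. u i * u j * ?G i j) = (if i = 0 then K (xs 0) (xs 0) else 0)"
      using \<open>0 < m\<close> by (simp add: u_def)
  qed
  ultimately have "?\<sigma> \<le> K (xs 0) (xs 0)"
    using eig(2)[of u] \<open>0 < m\<close> by simp
  also have "\<dots> \<le> \<kappa>\<^sup>2" using X \<open>0 < m\<close> by (intro K_diag) auto
  finally show "?\<sigma> \<le> \<kappa>\<^sup>2" .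
qed

text \<open>
  By symmetry of the Gram matrix \<open>G\<close> the interpolant at \<open>t\<close> is \<open>\<Sum>\<^sub>j b\<^sub>j y\<^sub>j\<close> with \<open>G b\<close> the vector of the
  \<open>K(x\<^sub>i, t)\<close>.  The form of \<open>K\<close> at \<open>\<Sum>\<^sub>j b\<^sub>j \<delta>(x\<^sub>j) - \<delta>(t)\<close> is the squared power function
  \<open>K(t,t) - b\<^sup>TGb\<close>, which lies between 0 and \<open>\<kappa>\<^sup>2\<close>.  Being at most \<open>\<kappa>\<^sup>2\<close> it controls the error of the
  weights at \<open>g\<close>; being nonnegative it yields \<open>\<sigma> |b|\<^sup>2 \<le> b\<^sup>TGb \<le> \<kappa>\<^sup>2\<close>, which
  controls how much the weights amplify the residuals \<open>y\<^sub>j - g(x\<^sub>j)\<close>.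
\<close>
lemma interpolant_deviation:
  assumes w: "w \<in> L2_space M" and xs: "xs ` {..<m} \<subseteq> space M" and "0 < m"
    and pd: "\<And>u. \<exists>i<m. u i \<noteq> 0 \<Longrightarrow> 0 < bform (\<lambda>i j. K (xs i) (xs j)) m u u"
    and t: "t \<in> space M"
  defines "g \<equiv> kernel_op M K w" and "\<sigma> \<equiv> gram_eig K m xs (m - 1)"
  shows "\<bar>interpolant K m xs y t - g t\<bar>
    \<le> \<kappa> * (sqrt (L2_inner M w g) + sqrt ((\<Sum>i<m. (y i - g (xs i))\<^sup>2) / \<sigma>))"
proof -
  let ?G = "\<lambda>i j. K (xs i) (xs j)"
  have X: "xs i \<in> space M" if "i < m" for i using xs that by auto
  have sym: "?G i j = ?G j i" if "i < m" "j < m" for i j using that by (intro K_sym X)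
  note eig = gram_smallest_eig[of m K xs, OF sym \<open>0 < m\<close>, folded \<sigma>_def]
  have "0 < \<sigma>"
    unfolding \<sigma>_def by (rule smallest_eig_bounds(1)[OF xs \<open>0 < m\<close> pd])
  have coeffs: "\<exists>a. (\<forall>s. interpolant K m xs y s = (\<Sum>i<m. a i * K (xs i) s)) \<and>
      (\<forall>i<m. (\<Sum>j<m. K (xs i) (xs j) * a j) = y i)" for y
    by (rule interpolant_coeffs) (rule pd)
  obtain a where a: "\<And>s. interpolant K m xs y s = (\<Sum>i<m. a i * K (xs i) s)"
    and Ga: "\<And>i. i < m \<Longrightarrow> (\<Sum>j<m. K (xs i) (xs j) * a j) = y i"
    using coeffs[of y] by blast
  obtain b where Gb: "\<And>i. i < m \<Longrightarrow> (\<Sum>j<m. K (xs i) (xs j) * b j) = K (xs i) t"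
    using coeffs[of "\<lambda>i. K (xs i) t"] by blast
  have "interpolant K m xs y t = (\<Sum>i<m. \<Sum>j<m. a i * (K (xs i) (xs j) * b j))"
    unfolding a by (intro sum.cong refl) (simp add: Gb[symmetric] sum_distrib_left)
  also have "\<dots> = (\<Sum>j<m. \<Sum>i<m. b j * (K (xs j) (xs i) * a i))"
    by (subst sum.swap) (intro sum.cong refl, simp add: sym mult_ac)
  also have "\<dots> = (\<Sum>j<m. b j * y j)"
    by (intro sum.cong refl) (simp add: Ga[symmetric] sum_distrib_left)
  finally have ft: "interpolant K m xs y t = (\<Sum>j<m. b j * y j)" .
  have bGb: "bform ?G m b b = (\<Sum>i<m. b i * K (xs i) t)"
    unfolding bform_def
    by (intro sum.cong refl) (simp add: Gb[symmetric] sum_distrib_left mult_ac)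
  define p where "p = xs(m := t)"
  define c where "c = b(m := -1)"
  have p: "p ` {..<Suc m} \<subseteq> space M" using X t by (auto simp: p_def less_Suc_eq)
  have "bform (\<lambda>i j. K (p i) (p j)) (Suc m) c c =
      bform ?G m b b - (\<Sum>i<m. b i * K (xs i) t) - (\<Sum>j<m. b j * K t (xs j)) + K t t"
    by (simp add: bform_def c_def p_def sum.distrib sum_negf sum_subtractf)
  also have "(\<Sum>j<m. b j * K t (xs j)) = (\<Sum>i<m. b i * K (xs i) t)"
    using X t by (intro sum.cong) (auto simp: K_sym)
  finally have P: "bform (\<lambda>i j. K (p i) (p j)) (Suc m) c c = K t t - bform ?G m b b"
    using bGb by simp
  then have bGb_le: "bform ?G m b b \<le> \<kappa>\<^sup>2"
    using K_psd[OF p, of c] K_diag[OF t] by linarith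
  have W: "0 \<le> L2_inner M w g" unfolding g_def using kernel_op_Cauchy_Schwarz(2)[OF w p] .
  have "((\<Sum>j<m. b j * g (xs j)) - g t)\<^sup>2 = (\<Sum>i<Suc m. c i * g (p i))\<^sup>2"
    by (simp add: c_def p_def)
  also have "\<dots> \<le> (K t t - bform ?G m b b) * L2_inner M w g"
    using kernel_op_Cauchy_Schwarz(1)[OF w p, of c] unfolding P g_def .
  also have "\<dots> \<le> \<kappa>\<^sup>2 * L2_inner M w g"
    using K_psd[of xs m b] xs K_diag[OF t] W by (intro mult_right_mono) auto
  finally have "sqrt (((\<Sum>j<m. b j * g (xs j)) - g t)\<^sup>2) \<le> sqrt (\<kappa>\<^sup>2 * L2_inner M w g)"
    by (rule real_sqrt_le_mono)
  then have part1: "\<bar>(\<Sum>j<m. b j * g (xs j)) - g t\<bar> \<le> \<kappa> * sqrt (L2_inner M w g)"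
    using \<kappa>_nonneg by (simp add: real_sqrt_mult)
  define u where "u j = y j - g (xs j)" for j
  have "\<bar>\<Sum>j<m. b j * u j\<bar> \<le> L2_set b {..<m} * L2_set u {..<m}"
    using L2_set_mult_ineq[of b u "{..<m}"] sum_abs[of "\<lambda>j. b j * u j" "{..<m}"]
    by (simp add: abs_mult)
  also have "\<dots> = sqrt ((\<Sum>j<m. (b j)\<^sup>2) * (\<Sum>j<m. (u j)\<^sup>2))"
    by (simp add: L2_set_def real_sqrt_mult)
  also have "\<dots> \<le> sqrt (\<kappa>\<^sup>2 / \<sigma> * (\<Sum>j<m. (u j)\<^sup>2))"
  proof (intro real_sqrt_le_mono mult_right_mono)
    show "(\<Sum>j<m. (b j)\<^sup>2) \<le> \<kappa>\<^sup>2 / \<sigma>"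
      using eig(2)[of b] bGb_le \<open>0 < \<sigma>\<close> by (simp add: field_simps)
  qed (simp add: sum_nonneg)
  also have "\<dots> = \<kappa> * sqrt ((\<Sum>j<m. (u j)\<^sup>2) / \<sigma>)"
    using \<kappa>_nonneg by (simp add: real_sqrt_mult real_sqrt_divide)
  finally have part2: "\<bar>\<Sum>j<m. b j * u j\<bar> \<le> \<kappa> * sqrt ((\<Sum>j<m. (u j)\<^sup>2) / \<sigma>)" .
  have "interpolant K m xs y t - g t = (\<Sum>j<m. b j * u j) + ((\<Sum>j<m. b j * g (xs j)) - g t)"
    unfolding ft u_def by (simp add: algebra_simps sum_subtractf)
  then show ?thesis
    using part1 part2 by (simp add: u_def algebra_simps)
qed

end

section \<open>A tail bound for sums of bounded nonnegative variables\<close>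

text \<open>
  The exponential Markov inequality for the sum divided by \<open>b\<close>.  For \<open>0 \<le> z \<le> 1\<close> one has
  \<open>exp z \<le> 1 + 2z\<close>, so each factor of the moment generating function is at most \<open>exp (2p/b)\<close>.  Positivity of
  the variables is what makes the deviation term linear in their upper bound \<open>b\<close>.
\<close>

lemma (in prob_space) empirical_sum_tail:
  fixes Z :: "'a \<Rightarrow> real" and m :: nat
  assumes Z [measurable]: "Z \<in> borel_measurable M"
    and bnd: "\<And>x. x \<in> space M \<Longrightarrow> 0 \<le> Z x \<and> Z x \<le> b" and "0 < b"
    and mean: "expectation Z \<le> p" and "0 < \<delta>"
  defines "P \<equiv> Pi\<^sub>M {..<m} (\<lambda>_. M)"
  shows "measure P {x \<in> space P. 2 * real m * p + b * ln (1 / \<delta>) \<le> (\<Sum>i<m. Z (x i))} \<le> \<delta>"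
proof -
  interpret P: finite_product_prob_space "\<lambda>_. M" "{..<m}" by unfold_locales auto
  define Y where "Y x = (\<Prod>i<m. exp (Z (x i) / b))" for x
  have exp_le: "exp (Z x / b) \<le> 1 + 2 * (Z x / b)" if "x \<in> space M" for x
  proof -
    have z: "0 \<le> Z x / b" "Z x / b \<le> 1" using bnd[OF that] \<open>0 < b\<close> by auto
    have "exp (Z x / b) \<le> 1 + Z x / b + (Z x / b)\<^sup>2" by (rule exp_bound[OF z])
    also have "(Z x / b)\<^sup>2 \<le> Z x / b"
      unfolding power2_eq_square using z by (intro mult_left_le) auto
    finally show ?thesis by simp
  qed
  have iZ: "integrable M Z"
    by (rule integrable_const_bound[of _ b]) (use bnd in auto)
  have "exp (Z x / b) \<le> 3" if "x \<in> space M" for x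
  proof -
    have "Z x / b \<le> 1" using bnd[OF that] \<open>0 < b\<close> by simp
    then show ?thesis using exp_le[OF that] by linarith
  qed
  then have iE: "integrable M (\<lambda>x. exp (Z x / b))"
    by (intro integrable_const_bound[of _ 3]) auto
  have "expectation (\<lambda>x. exp (Z x / b)) \<le> expectation (\<lambda>x. 1 + 2 * (Z x / b))"
    using iE iZ exp_le by (intro integral_mono) auto
  also have "\<dots> = 1 + 2 * (expectation Z / b)"
    using iZ by (simp add: prob_space)
  also have "\<dots> \<le> 1 + 2 * p / b"
    using mean \<open>0 < b\<close> by (simp add: field_simps)
  also have "\<dots> \<le> exp (2 * p / b)" by (rule exp_ge_add_one_self)
  finally have E1: "expectation (\<lambda>x. exp (Z x / b)) \<le> exp (2 * p / b)" .
  have Y_nonneg: "0 \<le> Y x" for x by (simp add: Y_def prod_nonneg)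
  have iY: "integrable P Y"
    unfolding P_def Y_def[abs_def] by (rule P.product_integrable_prod) (simp_all add: iE)
  have "(\<integral>x. Y x \<partial>P) = (\<Prod>i<m. expectation (\<lambda>x. exp (Z x / b)))"
    unfolding P_def Y_def by (rule P.product_integral_prod) (simp_all add: iE)
  also have "\<dots> \<le> exp (2 * p / b) ^ m"
    using E1 by (simp add: power_mono)
  finally have EY: "(\<integral>x. Y x \<partial>P) \<le> exp (2 * real m * p / b)"
    by (simp add: exp_of_nat_mult[symmetric] mult_ac)
  define c where "c = exp (2 * real m * p / b) / \<delta>"
  have "0 < c" using \<open>0 < \<delta>\<close> by (simp add: c_def)
  have "{x \<in> space P. 2 * real m * p + b * ln (1 / \<delta>) \<le> (\<Sum>i<m. Z (x i))} = {x \<in> space P. c \<le> Y x}"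
  proof -
    have "c = exp ((2 * real m * p + b * ln (1 / \<delta>)) / b)"
      using \<open>0 < \<delta>\<close> \<open>0 < b\<close> by (simp add: c_def exp_add add_divide_distrib)
    moreover have "Y x = exp ((\<Sum>i<m. Z (x i)) / b)" for x
      by (simp add: Y_def exp_sum sum_divide_distrib)
    ultimately show ?thesis using \<open>0 < b\<close> by (simp add: divide_le_cancel)
  qed
  also have "measure P \<dots> \<le> (\<integral>x. Y x \<partial>P) / c"
  proof -
    have "emeasure P {x \<in> space P. c \<le> Y x} \<le> ennreal (1 / c * (\<integral>x. Y x \<partial>P))"
      using iY \<open>0 < c\<close> by (intro integral_Markov_inequality) (auto simp: Y_nonneg)
    moreover have "0 \<le> 1 / c * (\<integral>x. Y x \<partial>P)"
      using \<open>0 < c\<close> by (intro mult_nonneg_nonneg integral_nonneg) (auto simp: Y_nonneg)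
    ultimately show ?thesis
      by (simp add: measure_def enn2real_leI)
  qed
  also have "\<dots> \<le> exp (2 * real m * p / b) / c"
    using EY \<open>0 < c\<close> by (intro divide_right_mono) auto
  also have "\<dots> = \<delta>" using \<open>0 < \<delta>\<close> by (simp add: c_def)
  finally show ?thesis .
qed

section \<open>A lower bound for the error bracket\<close>

text \<open>
  The ratio \<open>x/(t + x)\<close> increases with \<open>x\<close>, so each of the \<open>m\<close> terms of the effective dimension is at least its
  value at the smallest eigenvalue.  The two halves of \<open>A\<close> are used separately: \<open>1/sqrt t\<close> for the power \<open>2r\<close>,
  and \<open>sqrt (S/t)\<close>, with \<open>S\<close> the effective dimension, for the power 2.
\<close>

lemma error_bound_ge:
  fixes lam r :: real and m :: nat
  assumes "1 \<le> m" "0 < lam" "0 < r" "0 < \<sigma>"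
    and \<sigma>_min: "\<And>l. l < m \<Longrightarrow> \<sigma> \<le> gram_eig K m x l"
  defines "A \<equiv> A_quantity K m x lam"
  shows "2 * sqrt (real m / \<sigma>) * real m powr (- r) \<le>
    (1 + (1 + lam * real m * inverse \<sigma>) * (A + 1) powr (2 * r + 2)) * lam powr r +
    ((1 + lam * real m * inverse \<sigma>) + lam powr (r - 1 / 2)) * (A + 1)\<^sup>2 * sqrt lam * A"
proof -
  define t where "t = lam * real m"
  have "0 < t" using assms by (simp add: t_def)
  define S where "S = (\<Sum>l<m. gram_eig K m x l / (t + gram_eig K m x l))"
  have "real m * (\<sigma> / (t + \<sigma>)) = (\<Sum>l<m. \<sigma> / (t + \<sigma>))" by simp
  also have "\<dots> \<le> S"
    unfolding S_def
  proof (intro sum_mono)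
    fix l assume "l \<in> {..<m}"
    then have "\<sigma> \<le> gram_eig K m x l" by (intro \<sigma>_min) auto
    with \<open>0 < t\<close> \<open>0 < \<sigma>\<close> show "\<sigma> / (t + \<sigma>) \<le> gram_eig K m x l / (t + gram_eig K m x l)"
      by (simp add: field_simps)
  qed
  finally have S: "real m * (\<sigma> / (t + \<sigma>)) \<le> S" .
  then have "0 \<le> S" using \<open>0 < t\<close> \<open>0 < \<sigma>\<close> by (smt (verit) divide_nonneg_pos mult_nonneg_nonneg of_nat_0_le_iff)
  have A: "1 / sqrt t * max 1 (sqrt S) \<le> A"
    unfolding A_def A_quantity_def S_def t_def
    using assms by (intro mult_right_mono) (auto simp: mult_ac)
  have A1: "1 / sqrt t \<le> A"
    using A \<open>0 < t\<close> mult_left_mono[of 1 "max 1 (sqrt S)" "1 / sqrt t"] by auto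
  then have "0 < A" using \<open>0 < t\<close> by (smt (verit) divide_pos_pos real_sqrt_gt_zero)
  have "1 / sqrt t * sqrt S \<le> A"
    using A \<open>0 < t\<close> mult_left_mono[of "sqrt S" "max 1 (sqrt S)" "1 / sqrt t"] by auto
  then have "(1 / sqrt t * sqrt S)\<^sup>2 \<le> A\<^sup>2"
    using \<open>0 < t\<close> \<open>0 \<le> S\<close> by (intro power_mono) auto
  then have "S / t \<le> A\<^sup>2"
    using \<open>0 < t\<close> \<open>0 \<le> S\<close> by (simp add: power_mult_distrib power_divide)
  also have "A\<^sup>2 \<le> (A + 1)\<^sup>2 - 1" using \<open>0 < A\<close> by (simp add: power2_eq_square algebra_simps)
  finally have A2: "1 + S / t \<le> (A + 1)\<^sup>2" by simp
  have "2 * sqrt (real m / \<sigma>) = 2 * sqrt (t / \<sigma> * (real m / t))"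
    using \<open>0 < t\<close> by simp
  also have "\<dots> \<le> t / \<sigma> + real m / t"
    using arith_geo_mean_sqrt[of "t / \<sigma>" "real m / t"] \<open>0 < t\<close> \<open>0 < \<sigma>\<close> by simp
  also have "real m / t = (1 + t / \<sigma>) * (real m * (\<sigma> / (t + \<sigma>)) / t)"
    using \<open>0 < t\<close> \<open>0 < \<sigma>\<close> by (simp add: divide_simps)
  also have "\<dots> \<le> (1 + t / \<sigma>) * (S / t)"
    using \<open>0 < t\<close> \<open>0 < \<sigma>\<close> by (intro mult_left_mono divide_right_mono S) auto
  also have "t / \<sigma> + \<dots> \<le> (1 + t / \<sigma>) * (1 + S / t)"
    by (simp add: algebra_simps)
  also have "\<dots> \<le> (1 + t / \<sigma>) * (A + 1)\<^sup>2"
    using \<open>0 < t\<close> \<open>0 < \<sigma>\<close> by (intro mult_left_mono A2) auto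
  finally have main: "2 * sqrt (real m / \<sigma>) \<le> (1 + t / \<sigma>) * (A + 1)\<^sup>2" by simp
  have "real m powr (- r) = (1 / sqrt t) powr (2 * r) * lam powr r"
  proof -
    have "(1 / sqrt t) powr (2 * r) = (((1 / sqrt t) powr 2)) powr r"
      by (simp add: powr_powr)
    also have "\<dots> = (1 / t) powr r"
      using \<open>0 < t\<close> by (simp add: power_divide)
    finally have "(1 / sqrt t) powr (2 * r) * lam powr r = (1 / t * lam) powr r"
      using \<open>0 < t\<close> \<open>0 < lam\<close> powr_mult[of "1 / t" lam r] by simp
    also have "1 / t * lam = inverse (real m)"
      using assms by (simp add: t_def field_simps)
    finally show ?thesis by (simp add: inverse_powr powr_minus)
  qed
  also have "\<dots> \<le> (A + 1) powr (2 * r) * lam powr r"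
    using A1 \<open>0 < r\<close> \<open>0 < t\<close> by (intro mult_right_mono powr_mono2) auto
  finally have "real m powr (- r) \<le> (A + 1) powr (2 * r) * lam powr r" .
  then have "2 * sqrt (real m / \<sigma>) * real m powr (- r) \<le>
      ((1 + t / \<sigma>) * (A + 1)\<^sup>2) * ((A + 1) powr (2 * r) * lam powr r)"
    by (rule mult_mono[OF main]) (use \<open>0 < t\<close> \<open>0 < \<sigma>\<close> in auto)
  also have "\<dots> = (1 + lam * real m * inverse \<sigma>) * (A + 1) powr (2 * r + 2) * lam powr r"
    using \<open>0 < A\<close> by (simp add: t_def powr_add divide_inverse mult_ac)
  also have "\<dots> \<le> (1 + (1 + lam * real m * inverse \<sigma>) * (A + 1) powr (2 * r + 2)) * lam powr r"
    by (simp add: algebra_simps)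
  also have "\<dots> \<le> \<dots> + ((1 + lam * real m * inverse \<sigma>) + lam powr (r - 1 / 2)) * (A + 1)\<^sup>2 * sqrt lam * A"
    using assms(2,4) \<open>0 < A\<close> by (simp add: add_nonneg_nonneg)
  finally show ?thesis .
qed

section \<open>Error of the interpolant with high probability\<close>

lemma ln_24_div_ge_1:
  fixes \<delta> :: real
  assumes "0 < \<delta>" "\<delta> < 1"
  shows "1 \<le> ln (24 / \<delta>)"
proof -
  have "exp 1 \<le> (24 :: real)" using exp_le by linarith
  also have "\<dots> \<le> 24 / \<delta>" using assms by (simp add: le_divide_eq)
  finally show ?thesis using assms by (simp add: ln_ge_iff)
qed

context bounded_psd_kernel
begin

text \<open>
  The native-space part is \<open>L w\<close> with \<open>w = \<Sum> \<mu>\<^sub>i\<^bsup>r-1\<^esup> \<langle>h, e\<^sub>i\<rangle> e\<^sub>i\<close>, the sum over the \<open>i < n\<close> with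
  \<open>\<mu>\<^sub>i \<ge> \<tau>\<close>.  Truncating at a large \<open>n\<close> first keeps all sums finite, at the price of an additional
  error of at most \<open>\<tau>\<^sup>r\<close> coming from the convergence of the series.  As \<open>2r - 1 < 0\<close>, the eigenvalues above
  \<open>\<tau>\<close> have \<open>\<mu>\<^bsup>2r-1\<^esup> \<le> \<tau>\<^bsup>2r-1\<^esup>\<close>, and those below it have \<open>\<mu>\<^bsup>2r\<^esup> \<le> \<tau>\<^bsup>2r\<^esup>\<close>.
\<close>

lemma spectral_cutoff:
  assumes pw: "is_kernel_op_power M K r h f" and "0 < \<tau>" "0 < r" "r < 1 / 2"
  obtains w where "w \<in> L2_space M"
    and "L2_inner M w (kernel_op M K w) \<le> \<tau> powr (2 * r - 1) * (L2_norm M h)\<^sup>2"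
    and "(\<integral>x. (f x - kernel_op M K w x)\<^sup>2 \<partial>M) \<le> 2 * \<tau> powr (2 * r) * (1 + (L2_norm M h)\<^sup>2)"
proof -
  obtain N \<mu> e where h: "h \<in> L2_space M" and f: "f \<in> L2_space M" and es: "eigensystem M K N \<mu> e"
    and lim: "(\<lambda>n. L2_norm M (\<lambda>x. f x - (\<Sum>i\<in>N \<inter> {..<n}. \<mu> i powr r * L2_inner M h (e i) * e i x)))
      \<longlonglongrightarrow> 0"
    using pw unfolding is_kernel_op_power_def by blast
  have eL2: "e i \<in> L2_space M" and \<mu>: "0 < \<mu> i"
    and eig: "AE x in M. kernel_op M K (e i) x = \<mu> i * e i x" if "i \<in> N" for i
    using es that by (auto simp: eigensystem_def)
  have on: "orthonormal_family M G e" if "finite G" "G \<subseteq> N" for G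
    using es that by unfold_locales (auto simp: eigensystem_def subset_iff)
  define c where "c i = L2_inner M h (e i)" for i
  define s where "s G = (\<lambda>x. \<Sum>i\<in>G. (\<mu> i powr r * c i) * e i x)" for G
  have "0 < \<tau> powr r" using \<open>0 < \<tau>\<close> by simp
  from LIMSEQ_D[OF lim this] obtain n
    where "norm (L2_norm M (\<lambda>x. f x - s (N \<inter> {..<n}) x) - 0) < \<tau> powr r"
    unfolding s_def c_def by blast
  then have "L2_norm M (\<lambda>x. f x - s (N \<inter> {..<n}) x) \<le> \<tau> powr r" by simp
  then have tail: "(L2_norm M (\<lambda>x. f x - s (N \<inter> {..<n}) x))\<^sup>2 \<le> (\<tau> powr r)\<^sup>2"
    by (intro power_mono) (auto simp: L2_norm_def L2_inner_self)
  define F where "F = {i \<in> N \<inter> {..<n}. \<tau> \<le> \<mu> i}"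
  define F' where "F' = {i \<in> N \<inter> {..<n}. \<mu> i < \<tau>}"
  have fin: "finite F" "finite F'" and sub: "F \<subseteq> N" "F' \<subseteq> N"
    by (auto simp: F_def F'_def)
  interpret F: orthonormal_family M F e by (rule on[OF fin(1) sub(1)])
  interpret F': orthonormal_family M F' e by (rule on[OF fin(2) sub(2)])
  have split: "s (N \<inter> {..<n}) x = s F x + s F' x" for x
  proof -
    have "N \<inter> {..<n} = F \<union> F'" "F \<inter> F' = {}" by (auto simp: F_def F'_def)
    then show ?thesis unfolding s_def using fin by (simp add: sum.union_disjoint)
  qed
  define w where "w = (\<lambda>x. \<Sum>i\<in>F. (\<mu> i powr (r - 1) * c i) * e i x)"
  have w: "w \<in> L2_space M" unfolding w_def by (intro L2_sum L2_scale F.L2)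
  have sL2: "s G \<in> L2_space M" if "G \<subseteq> N" for G
    unfolding s_def using that by (intro L2_sum L2_scale eL2) auto
  have "AE x in M. \<forall>i\<in>F. kernel_op M K (e i) x = \<mu> i * e i x"
    using fin(1) sub(1) eig by (subst AE_finite_all) auto
  then have Lw: "AE x in M. kernel_op M K w x = s F x"
  proof (rule AE_mp, intro AE_I2 impI)
    fix y assume y: "y \<in> space M" and ev: "\<forall>i\<in>F. kernel_op M K (e i) y = \<mu> i * e i y"
    have "kernel_op M K w y = (\<integral>x. (\<Sum>i\<in>F. (\<mu> i powr (r - 1) * c i) * (e i x * K x y)) \<partial>M)"
      unfolding kernel_op_def w_def by (simp add: sum_distrib_right mult.assoc)
    also have "\<dots> = (\<Sum>i\<in>F. (\<mu> i powr (r - 1) * c i) * kernel_op M K (e i) y)"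
      unfolding kernel_op_def using integrable_kernel_section[OF F.L2 y]
      by (subst Bochner_Integration.integral_sum) auto
    also have "\<dots> = s F y"
      unfolding s_def
    proof (intro sum.cong refl)
      fix i assume "i \<in> F"
      then have "0 < \<mu> i" using sub(1) \<mu> by auto
      then have "\<mu> i powr (r - 1) * \<mu> i = \<mu> i powr r"
        by (simp add: powr_diff)
      then show "\<mu> i powr (r - 1) * c i * kernel_op M K (e i) y = \<mu> i powr r * c i * e i y"
        using ev \<open>i \<in> F\<close> by (simp add: mult_ac)
    qed
    finally show "kernel_op M K w y = s F y" .
  qed
  have [measurable]: "w \<in> borel_measurable M" "kernel_op M K w \<in> borel_measurable M"
    "s F \<in> borel_measurable M" "f \<in> borel_measurable M"
    using w f sL2[OF sub(1)] kernel_op_measurable[OF w] by (auto simp: L2_space_def)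
  have "L2_inner M w (kernel_op M K w) = L2_inner M w (s F)"
    unfolding L2_inner_def by (rule integral_cong_AE) (use Lw in auto)
  also have "\<dots> = (\<Sum>i\<in>F. \<mu> i powr (2 * r - 1) * (c i)\<^sup>2)"
    unfolding w_def s_def F.inner_combination
  proof (intro sum.cong refl)
    fix i assume "i \<in> F"
    have "\<mu> i powr (2 * r - 1) = \<mu> i powr (r - 1) * \<mu> i powr r"
      by (simp add: powr_add[symmetric])
    then show "\<mu> i powr (r - 1) * c i * (\<mu> i powr r * c i) = \<mu> i powr (2 * r - 1) * (c i)\<^sup>2"
      by (simp add: power2_eq_square)
  qed
  also have "\<dots> \<le> (\<Sum>i\<in>F. \<tau> powr (2 * r - 1) * (c i)\<^sup>2)"
    using \<open>0 < \<tau>\<close> \<open>r < 1 / 2\<close>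
    by (intro sum_mono mult_right_mono powr_mono2') (auto simp: F_def)
  also have "\<dots> \<le> \<tau> powr (2 * r - 1) * (L2_norm M h)\<^sup>2"
    unfolding sum_distrib_left[symmetric] c_def by (intro mult_left_mono F.Bessel_inequality h) auto
  finally have W: "L2_inner M w (kernel_op M K w) \<le> \<tau> powr (2 * r - 1) * (L2_norm M h)\<^sup>2" .
  let ?d = "\<lambda>x. f x - s (N \<inter> {..<n}) x"
  have dL2: "?d \<in> L2_space M" by (intro L2_diff f sL2) auto
  have "(\<integral>x. (f x - kernel_op M K w x)\<^sup>2 \<partial>M) = (\<integral>x. (f x - s F x)\<^sup>2 \<partial>M)"
    by (rule integral_cong_AE) (use Lw in auto)
  also have "\<dots> \<le> (\<integral>x. 2 * (?d x)\<^sup>2 + 2 * (s F' x)\<^sup>2 \<partial>M)"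
  proof (rule integral_mono)
    show "integrable M (\<lambda>x. (f x - s F x)\<^sup>2)"
      using L2_diff[OF f sL2[OF sub(1)]] by (simp add: L2_space_def)
    show "integrable M (\<lambda>x. 2 * (?d x)\<^sup>2 + 2 * (s F' x)\<^sup>2)"
      using dL2 sL2[OF sub(2)] by (simp add: L2_space_def)
    show "(f x - s F x)\<^sup>2 \<le> 2 * (?d x)\<^sup>2 + 2 * (s F' x)\<^sup>2" for x
      using sum_squares_bound[of "?d x" "s F' x"]
      by (simp add: split power2_eq_square algebra_simps)
  qed
  also have "\<dots> = 2 * (L2_norm M ?d)\<^sup>2 + 2 * L2_inner M (s F') (s F')"
    using dL2 sL2[OF sub(2)] by (simp add: L2_space_def L2_norm_sq L2_inner_self)
  also have "L2_inner M (s F') (s F') = (\<Sum>i\<in>F'. (\<mu> i powr r)\<^sup>2 * (c i)\<^sup>2)"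
    unfolding s_def F'.inner_combination by (simp add: power2_eq_square mult_ac)
  also have "\<dots> \<le> (\<Sum>i\<in>F'. (\<tau> powr r)\<^sup>2 * (c i)\<^sup>2)"
    using \<open>0 < r\<close> \<mu> sub(2)
    by (intro sum_mono mult_right_mono power_mono powr_mono2) (auto simp: F'_def less_imp_le)
  also have "\<dots> \<le> (\<tau> powr r)\<^sup>2 * (L2_norm M h)\<^sup>2"
    unfolding sum_distrib_left[symmetric] c_def by (intro mult_left_mono F'.Bessel_inequality h) auto
  also have "2 * (L2_norm M ?d)\<^sup>2 + 2 * ((\<tau> powr r)\<^sup>2 * (L2_norm M h)\<^sup>2)
      \<le> 2 * (\<tau> powr r)\<^sup>2 + 2 * ((\<tau> powr r)\<^sup>2 * (L2_norm M h)\<^sup>2)"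
    using tail by simp
  also have "\<dots> = 2 * \<tau> powr (2 * r) * (1 + (L2_norm M h)\<^sup>2)"
    using \<open>0 < \<tau>\<close> by (simp add: powr_power algebra_simps)
  finally show ?thesis using that[OF w W] by simp
qed

lemma interpolant_measurable:
  assumes "xs ` {..<m} \<subseteq> space M"
  shows "interpolant K m xs y \<in> borel_measurable M"
proof -
  have "K (xs i) \<in> borel_measurable M" if "i < m" for i
    using measurable_Pair2[OF K_measurable, of "xs i"] assms that by auto
  then show ?thesis
    unfolding interpolant_def Let_def by (intro borel_measurable_sum borel_measurable_times) auto
qed

text \<open>
  The error at \<open>t\<close> splits into \<open>f - g\<close> and the deviation of the interpolant from \<open>g\<close>, where \<open>g\<close> is the cutoff of
  \<open>f\<close> at level \<open>1/m\<close>.  The function \<open>g\<close> depends on \<open>f\<close> and \<open>m\<close> but not on the sample, so the tail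
  bound applies to the values of \<open>(f - g)\<^sup>2\<close> at the sample points.  In the proof \<open>\<epsilon> = m\<^sup>-\<^sup>r\<close>, and \<open>q = sqrt m \<epsilon>\<close> is
  the size of the native norm of \<open>g\<close>.
\<close>
lemma interpolation_error_high_probability:
  fixes m :: nat and r \<delta> B :: real
  assumes pw: "is_kernel_op_power M K r h f" and r: "0 < r" "r < 1 / 2" and "1 \<le> m"
    and \<delta>: "0 < \<delta>" "\<delta> < 1"
    and f_bound: "\<And>x. x \<in> space M \<Longrightarrow> \<bar>f x\<bar> \<le> B"
    and pd: "\<And>xs u. xs ` {..<m} \<subseteq> space M \<Longrightarrow> inj_on xs {..<m} \<Longrightarrow> \<exists>i<m. u i \<noteq> 0 \<Longrightarrow>
      0 < bform (\<lambda>i j. K (xs i) (xs j)) m u u"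
  defines "P \<equiv> Pi\<^sub>M {..<m} (\<lambda>_. M)" and "H \<equiv> L2_norm M h"
  shows "\<exists>E\<in>sets P. 1 - \<delta> \<le> measure P E \<and>
    (\<forall>xs\<in>E. \<forall>y. inj_on xs {..<m} \<longrightarrow> (\<forall>i<m. y i = f (xs i)) \<longrightarrow>
      L2_norm M (\<lambda>t. f t - interpolant K m xs y t) \<le>
        2 * \<kappa> * (4 + 3 * H + B + 2 * \<kappa> * H) * ln (24 / \<delta>) *
        (sqrt (real m / gram_eig K m xs (m - 1)) * real m powr (- r)))"
proof -
  have "0 < m" "0 < real m" using \<open>1 \<le> m\<close> by auto
  define l where "l = ln (24 / \<delta>)"
  have l1: "1 \<le> l" unfolding l_def using \<delta> by (rule ln_24_div_ge_1)
  have l\<delta>: "ln (1 / \<delta>) \<le> l" unfolding l_def using \<delta> by (subst ln_le_cancel_iff) (auto simp: field_simps)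
  have H: "0 \<le> H" unfolding H_def L2_norm_def L2_inner_self by simp
  obtain x0 where "x0 \<in> space M" using not_empty by blast
  then have B: "0 \<le> B" using f_bound[of x0] by linarith
  obtain w where w: "w \<in> L2_space M"
    and W: "L2_inner M w (kernel_op M K w) \<le> (1 / real m) powr (2 * r - 1) * H\<^sup>2"
    and apx: "(\<integral>x. (f x - kernel_op M K w x)\<^sup>2 \<partial>M) \<le> 2 * (1 / real m) powr (2 * r) * (1 + H\<^sup>2)"
    unfolding H_def using spectral_cutoff[OF pw _ r, of "1 / real m"] \<open>0 < m\<close> by auto
  define g where "g = kernel_op M K w"
  define \<epsilon> where "\<epsilon> = real m powr (- r)"
  have \<epsilon>: "0 < \<epsilon>" using \<open>0 < m\<close> by (simp add: \<epsilon>_def)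
  have \<epsilon>_sq: "(1 / real m) powr (2 * r) = \<epsilon>\<^sup>2"
  proof -
    have "(1 / real m) powr (2 * r) = real m powr (- (2 * r))"
      using \<open>0 < m\<close> by (simp add: powr_divide powr_minus_divide)
    also have "\<dots> = \<epsilon>\<^sup>2"
      by (simp add: \<epsilon>_def power2_eq_square powr_add[symmetric])
    finally show ?thesis .
  qed
  have "(1 / real m) powr (2 * r - 1) = \<epsilon>\<^sup>2 * real m"
    using \<open>0 < m\<close> by (simp add: powr_diff \<epsilon>_sq)
  then have W': "L2_inner M w g \<le> real m * \<epsilon>\<^sup>2 * H\<^sup>2" using W by (simp add: g_def mult_ac)
  define q where "q = sqrt (real m) * \<epsilon>"
  have q_sq: "q\<^sup>2 = real m * \<epsilon>\<^sup>2" by (simp add: q_def power_mult_distrib)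
  have "sqrt (L2_inner M w g) \<le> sqrt ((q * H)\<^sup>2)"
    using W' by (intro real_sqrt_le_mono) (simp add: power_mult_distrib q_sq)
  then have sW: "sqrt (L2_inner M w g) \<le> q * H" using \<epsilon> H by (simp add: q_def)
  have q1: "1 \<le> q"
  proof -
    have "q = real m powr (1 / 2 - r)"
      using \<open>0 < m\<close> by (simp add: q_def \<epsilon>_def powr_half_sqrt[symmetric] powr_add[symmetric])
    then show ?thesis using \<open>1 \<le> m\<close> r by (simp add: ge_one_powr_ge_zero)
  qed
  \<comment> \<open>The summand 1 only ensures that \<open>b\<close> is positive.\<close>
  define b where "b = ((1 + B + \<kappa> * H) * q)\<^sup>2"
  have f: "f \<in> L2_space M" using pw by (simp add: is_kernel_op_power_def)
  have fg: "(\<lambda>x. f x - g x) \<in> L2_space M" unfolding g_def by (intro L2_diff f kernel_op_L2 w)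
  then have Zm [measurable]: "(\<lambda>x. (f x - g x)\<^sup>2) \<in> borel_measurable M"
    by (auto simp: L2_space_def)
  have Zb: "0 \<le> (f x - g x)\<^sup>2 \<and> (f x - g x)\<^sup>2 \<le> b" if "x \<in> space M" for x
  proof -
    have "\<bar>g x\<bar> \<le> \<kappa> * sqrt (L2_inner M w g)"
      unfolding g_def by (rule kernel_op_pointwise_bound[OF w that])
    also have "\<dots> \<le> \<kappa> * (q * H)" by (intro mult_left_mono sW \<kappa>_nonneg)
    finally have "\<bar>f x - g x\<bar> \<le> B + \<kappa> * H * q" using f_bound[OF that] by (simp add: mult_ac)
    also have "\<dots> \<le> (1 + B) * q + \<kappa> * H * q"
      using B q1 mult_mono[of B "1 + B" 1 q] by simp
    finally have "\<bar>f x - g x\<bar> \<le> (1 + B + \<kappa> * H) * q" by (simp add: algebra_simps)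
    then have "\<bar>f x - g x\<bar>\<^sup>2 \<le> b" unfolding b_def by (intro power_mono) auto
    then show ?thesis by simp
  qed
  have "0 < (1 + B + \<kappa> * H) * q"
    using B H \<kappa>_nonneg q1 by (intro mult_pos_pos) (auto simp: add_pos_nonneg)
  then have "0 < b" unfolding b_def by (rule zero_less_power)
  define p where "p = 2 * \<epsilon>\<^sup>2 * (1 + H\<^sup>2)"
  have mean: "(\<integral>x. (f x - g x)\<^sup>2 \<partial>M) \<le> p" using apx by (simp add: p_def g_def \<epsilon>_sq)
  define T where "T = 2 * real m * p + b * ln (1 / \<delta>)"
  define Bad where "Bad = {x \<in> space P. T \<le> (\<Sum>i<m. (f (x i) - g (x i))\<^sup>2)}"
  interpret P: finite_product_prob_space "\<lambda>_. M" "{..<m}" by unfold_locales auto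
  have "(\<lambda>x. \<Sum>i<m. (f (x i) - g (x i))\<^sup>2) \<in> borel_measurable P"
    unfolding P_def
    by (intro borel_measurable_sum measurable_compose[OF _ Zm] measurable_component_singleton) auto
  then have Bad: "Bad \<in> sets P" unfolding Bad_def by measurable
  have "measure P Bad \<le> \<delta>"
    using empirical_sum_tail[OF Zm Zb \<open>0 < b\<close> mean \<delta>(1), of m] by (simp add: Bad_def T_def P_def)
  moreover have "measure P (space P - Bad) = 1 - measure P Bad"
    using Bad unfolding P_def by (rule P.prob_compl)
  ultimately have "1 - \<delta> \<le> measure P (space P - Bad)" by simp
  define G where "G = 3 + 2 * H + B + \<kappa> * H"
  have T: "T \<le> real m * (\<epsilon> * G * l)\<^sup>2"
  proof -
    have nn: "0 \<le> \<kappa> * H" using \<kappa>_nonneg H by simp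
    have "T = real m * \<epsilon>\<^sup>2 * (4 * (1 + H\<^sup>2) + (1 + B + \<kappa> * H)\<^sup>2 * ln (1 / \<delta>))"
      unfolding T_def p_def b_def power_mult_distrib q_sq by (simp add: algebra_simps)
    also have "\<dots> \<le> real m * \<epsilon>\<^sup>2 * (G\<^sup>2 * l\<^sup>2)"
    proof (intro mult_left_mono)
      have "l \<le> l\<^sup>2" using l1 by (simp add: power2_eq_square)
      have "4 * (1 + H\<^sup>2) + (1 + B + \<kappa> * H)\<^sup>2 * ln (1 / \<delta>)
          \<le> (2 * (1 + H))\<^sup>2 * l\<^sup>2 + (1 + B + \<kappa> * H)\<^sup>2 * l\<^sup>2"
      proof (intro add_mono mult_left_mono)
        have "4 * (1 + H\<^sup>2) \<le> (2 * (1 + H))\<^sup>2 * 1"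
          using H by (simp add: power2_eq_square algebra_simps)
        also have "\<dots> \<le> (2 * (1 + H))\<^sup>2 * l\<^sup>2" using l1 by (intro mult_left_mono) auto
        finally show "4 * (1 + H\<^sup>2) \<le> (2 * (1 + H))\<^sup>2 * l\<^sup>2" .
        show "ln (1 / \<delta>) \<le> l\<^sup>2" using l\<delta> \<open>l \<le> l\<^sup>2\<close> by linarith
      qed auto
      also have "\<dots> = ((2 * (1 + H))\<^sup>2 + (1 + B + \<kappa> * H)\<^sup>2) * l\<^sup>2" by (simp add: algebra_simps)
      also have "\<dots> \<le> G\<^sup>2 * l\<^sup>2"
      proof (intro mult_right_mono)
        have "G = 2 * (1 + H) + (1 + B + \<kappa> * H)" by (simp add: G_def)
        then have "G\<^sup>2 = (2 * (1 + H))\<^sup>2 + (1 + B + \<kappa> * H)\<^sup>2 + 2 * (2 * (1 + H)) * (1 + B + \<kappa> * H)"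
          by (simp only: power2_sum)
        moreover have "0 \<le> 2 * (2 * (1 + H)) * (1 + B + \<kappa> * H)"
          using H B nn by (intro mult_nonneg_nonneg) auto
        ultimately show "(2 * (1 + H))\<^sup>2 + (1 + B + \<kappa> * H)\<^sup>2 \<le> G\<^sup>2"
          by (simp only: le_add_same_cancel1)
      qed auto
      finally show "4 * (1 + H\<^sup>2) + (1 + B + \<kappa> * H)\<^sup>2 * ln (1 / \<delta>) \<le> G\<^sup>2 * l\<^sup>2" .
    qed auto
    finally show ?thesis by (simp add: power_mult_distrib mult_ac)
  qed
  have G: "0 \<le> G" using H B \<kappa>_nonneg by (simp add: G_def)
  have "L2_norm M (\<lambda>t. f t - interpolant K m xs y t) \<le>
        2 * \<kappa> * (4 + 3 * H + B + 2 * \<kappa> * H) * l * (sqrt (real m / gram_eig K m xs (m - 1)) * \<epsilon>)"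
    if E: "xs \<in> space P - Bad" and inj: "inj_on xs {..<m}" and y: "\<And>i. i < m \<Longrightarrow> y i = f (xs i)"
    for xs y
  proof -
    have xs: "xs ` {..<m} \<subseteq> space M"
      using E by (auto simp: P_def space_PiM PiE_def Pi_def)
    define \<sigma> where "\<sigma> = gram_eig K m xs (m - 1)"
    have \<sigma>: "0 < \<sigma>" "\<sigma> \<le> \<kappa>\<^sup>2"
      unfolding \<sigma>_def using smallest_eig_bounds[OF xs \<open>0 < m\<close> pd[OF xs inj]] by auto
    define \<theta> where "\<theta> = sqrt (real m / \<sigma>) * \<epsilon>"
    have \<theta>: "0 \<le> \<theta>" using \<epsilon> \<sigma> by (simp add: \<theta>_def)
    have q_le: "q \<le> \<kappa> * \<theta>"
    proof -
      have "sqrt \<sigma> \<le> \<kappa>"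
        using real_sqrt_le_mono[OF \<sigma>(2)] \<kappa>_nonneg by simp
      have "q = sqrt \<sigma> * \<theta>"
        using \<sigma>(1) by (simp add: q_def \<theta>_def real_sqrt_divide)
      also have "\<dots> \<le> \<kappa> * \<theta>" by (intro mult_right_mono \<open>sqrt \<sigma> \<le> \<kappa>\<close> \<theta>)
      finally show ?thesis .
    qed
    have \<epsilon>_le: "\<epsilon> \<le> \<kappa> * \<theta>"
    proof -
      have "\<epsilon> \<le> sqrt (real m) * \<epsilon>"
        using \<open>1 \<le> m\<close> \<epsilon> mult_right_mono[of 1 "sqrt (real m)" \<epsilon>] by simp
      then show ?thesis using q_le by (simp add: q_def)
    qed
    define s where "s = \<kappa> * (\<kappa> * H + G) * (\<theta> * l)"
    have point: "\<bar>interpolant K m xs y t - g t\<bar> \<le> s" if t: "t \<in> space M" for t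
    proof -
      have "(\<Sum>i<m. (y i - g (xs i))\<^sup>2) = (\<Sum>i<m. (f (xs i) - g (xs i))\<^sup>2)"
        by (intro sum.cong) (auto simp: y)
      also have "\<dots> \<le> real m * (\<epsilon> * G * l)\<^sup>2"
        using E T by (auto simp: Bad_def)
      finally have "sqrt ((\<Sum>i<m. (y i - g (xs i))\<^sup>2) / \<sigma>) \<le> sqrt (real m * (\<epsilon> * G * l)\<^sup>2 / \<sigma>)"
        using \<sigma> by (intro real_sqrt_le_mono divide_right_mono) auto
      also have "\<dots> = \<theta> * G * l"
        using \<epsilon> G l1 by (simp add: \<theta>_def real_sqrt_mult real_sqrt_divide)
      finally have noise: "sqrt ((\<Sum>i<m. (y i - g (xs i))\<^sup>2) / \<sigma>) \<le> \<theta> * G * l" .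
      have "\<bar>interpolant K m xs y t - g t\<bar>
          \<le> \<kappa> * (sqrt (L2_inner M w g) + sqrt ((\<Sum>i<m. (y i - g (xs i))\<^sup>2) / \<sigma>))"
        unfolding g_def \<sigma>_def by (rule interpolant_deviation[OF w xs \<open>0 < m\<close> pd[OF xs inj] t])
      also have "\<dots> \<le> \<kappa> * (\<kappa> * \<theta> * H * l + \<theta> * G * l)"
      proof (intro mult_left_mono add_mono noise \<kappa>_nonneg)
        have "q * H \<le> \<kappa> * \<theta> * H" by (intro mult_right_mono q_le H)
        also have "\<dots> \<le> \<kappa> * \<theta> * H * l"
          using mult_left_mono[OF l1, of "\<kappa> * \<theta> * H"] \<kappa>_nonneg \<theta> H by simp
        finally show "sqrt (L2_inner M w g) \<le> \<kappa> * \<theta> * H * l" using sW by linarith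
      qed
      also have "\<dots> = s" by (simp add: s_def algebra_simps)
      finally show ?thesis .
    qed
    have s: "0 \<le> s" using \<kappa>_nonneg H G \<theta> l1 by (simp add: s_def)
    have im: "interpolant K m xs y \<in> borel_measurable M" by (rule interpolant_measurable[OF xs])
    have gm: "g \<in> borel_measurable M" unfolding g_def by (rule kernel_op_measurable[OF w])
    have "(\<integral>t. (f t - interpolant K m xs y t)\<^sup>2 \<partial>M) \<le> (\<integral>t. 2 * (f t - g t)\<^sup>2 + 2 * s\<^sup>2 \<partial>M)"
    proof (rule integral_mono_AE')
      show "integrable M (\<lambda>t. 2 * (f t - g t)\<^sup>2 + 2 * s\<^sup>2)"
        using fg by (simp add: L2_space_def)
      have "(f t - interpolant K m xs y t)\<^sup>2 \<le> 2 * (f t - g t)\<^sup>2 + 2 * s\<^sup>2" if "t \<in> space M" for t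
      proof -
        have "(interpolant K m xs y t - g t)\<^sup>2 \<le> s\<^sup>2"
          using power_mono[OF point[OF that], of 2] by simp
        then show ?thesis
          using sum_squares_bound[of "f t - g t" "g t - interpolant K m xs y t"]
          by (simp add: power2_eq_square algebra_simps)
      qed
      then show "AE t in M. (f t - interpolant K m xs y t)\<^sup>2 \<le> 2 * (f t - g t)\<^sup>2 + 2 * s\<^sup>2" by auto
    qed auto
    also have "\<dots> = 2 * (\<integral>t. (f t - g t)\<^sup>2 \<partial>M) + 2 * s\<^sup>2"
      using fg by (simp add: L2_space_def prob_space)
    also have "\<dots> \<le> 2 * p + 2 * s\<^sup>2" using mean by simp
    also have "2 * p \<le> (2 * \<kappa> * (1 + H) * (\<theta> * l))\<^sup>2"
    proof -
      have "\<epsilon> \<le> \<kappa> * (\<theta> * l)"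
        using \<epsilon>_le mult_left_mono[OF l1, of "\<kappa> * \<theta>"] \<kappa>_nonneg \<theta> by (simp add: mult_ac)
      then have "2 * \<epsilon> * (1 + H) \<le> 2 * (\<kappa> * (\<theta> * l)) * (1 + H)"
        using H by (intro mult_right_mono) auto
      then have "(2 * \<epsilon> * (1 + H))\<^sup>2 \<le> (2 * (\<kappa> * (\<theta> * l)) * (1 + H))\<^sup>2"
        using \<epsilon> H by (intro power_mono) auto
      moreover have "2 * p \<le> (2 * \<epsilon> * (1 + H))\<^sup>2"
      proof -
        have "1 + H\<^sup>2 \<le> (1 + H)\<^sup>2" using H by (simp add: power2_sum)
        then have "4 * \<epsilon>\<^sup>2 * (1 + H\<^sup>2) \<le> 4 * \<epsilon>\<^sup>2 * (1 + H)\<^sup>2"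
          by (intro mult_left_mono) auto
        moreover have "(2 * \<epsilon> * (1 + H))\<^sup>2 = 4 * \<epsilon>\<^sup>2 * (1 + H)\<^sup>2"
          unfolding power_mult_distrib by simp
        ultimately show ?thesis by (simp add: p_def)
      qed
      ultimately show ?thesis by (simp add: mult_ac)
    qed
    also have "(2 * \<kappa> * (1 + H) * (\<theta> * l))\<^sup>2 + 2 * s\<^sup>2 \<le> (2 * \<kappa> * (1 + H) * (\<theta> * l) + 2 * s)\<^sup>2"
    proof -
      define z where "z = 2 * \<kappa> * (1 + H) * (\<theta> * l)"
      have "0 \<le> z * s"
        using \<kappa>_nonneg H \<theta> l1 s by (simp add: z_def)
      then show ?thesis unfolding z_def[symmetric] by (simp add: power2_sum power_mult_distrib)
    qed
    also have "2 * \<kappa> * (1 + H) * (\<theta> * l) + 2 * s = 2 * \<kappa> * (4 + 3 * H + B + 2 * \<kappa> * H) * l * \<theta>"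
      by (simp add: s_def G_def algebra_simps)
    finally have "(\<integral>t. (f t - interpolant K m xs y t)\<^sup>2 \<partial>M)
        \<le> (2 * \<kappa> * (4 + 3 * H + B + 2 * \<kappa> * H) * l * \<theta>)\<^sup>2" by simp
    then have "L2_norm M (\<lambda>t. f t - interpolant K m xs y t)
        \<le> sqrt ((2 * \<kappa> * (4 + 3 * H + B + 2 * \<kappa> * H) * l * \<theta>)\<^sup>2)"
      unfolding L2_norm_def L2_inner_self by (rule real_sqrt_le_mono)
    also have "\<dots> = 2 * \<kappa> * (4 + 3 * H + B + 2 * \<kappa> * H) * l * \<theta>"
      using \<kappa>_nonneg H B l1 \<theta> by simp
    finally show ?thesis by (simp add: \<theta>_def \<sigma>_def)
  qed
  then show ?thesis
    using Bad \<open>1 - \<delta> \<le> measure P (space P - Bad)\<close> unfolding l_def \<epsilon>_def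
    by (intro bexI[of _ "space P - Bad"]) auto
qed

end

section \<open>The interpolation error on a compact domain\<close>

text \<open>
  Repeated points are merged by adding up their weights.
\<close>
lemma strictly_pos_def_sequence:
  assumes spd: "strictly_pos_def_on X K" and p: "p ` {..<n} \<subseteq> X"
  shows "0 \<le> bform (\<lambda>i j. K (p i) (p j)) n c c"
    and "inj_on p {..<n} \<Longrightarrow> \<exists>i<n. c i \<noteq> 0 \<Longrightarrow> 0 < bform (\<lambda>i j. K (p i) (p j)) n c c"
proof -
  define S where "S = p ` {..<n}"
  define C where "C x = (\<Sum>i | i \<in> {..<n} \<and> p i = x. c i)" for x
  have merge: "(\<Sum>i<n. c i * \<phi> (p i)) = (\<Sum>x\<in>S. C x * \<phi> x)" for \<phi> :: "'a \<Rightarrow> real"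
  proof -
    have "(\<Sum>i<n. c i * \<phi> (p i)) = (\<Sum>x\<in>S. \<Sum>i | i \<in> {..<n} \<and> p i = x. c i * \<phi> (p i))"
      unfolding S_def by (rule sum.image_gen) simp
    also have "\<dots> = (\<Sum>x\<in>S. C x * \<phi> x)"
      unfolding C_def sum_distrib_right by (intro sum.cong) auto
    finally show ?thesis .
  qed
  have "bform (\<lambda>i j. K (p i) (p j)) n c c = (\<Sum>i<n. c i * (\<Sum>j<n. c j * K (p i) (p j)))"
    by (simp add: bform_def sum_distrib_left mult.assoc)
  also have "\<dots> = (\<Sum>x\<in>S. C x * (\<Sum>j<n. c j * K x (p j)))" by (rule merge)
  also have "\<dots> = (\<Sum>x\<in>S. C x * (\<Sum>y\<in>S. C y * K x y))" by (simp only: merge)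
  also have "\<dots> = (\<Sum>x\<in>S. \<Sum>y\<in>S. C x * C y * K x y)"
    by (simp add: sum_distrib_left mult.assoc)
  finally have form: "bform (\<lambda>i j. K (p i) (p j)) n c c = (\<Sum>x\<in>S. \<Sum>y\<in>S. C x * C y * K x y)" .
  have S: "finite S" "S \<subseteq> X" using p by (auto simp: S_def)
  have pos: "0 < (\<Sum>x\<in>S. \<Sum>y\<in>S. C x * C y * K x y)" if "\<exists>x\<in>S. C x \<noteq> 0"
    using spd S that unfolding strictly_pos_def_on_def by blast
  show "0 \<le> bform (\<lambda>i j. K (p i) (p j)) n c c"
  proof (cases "\<exists>x\<in>S. C x \<noteq> 0")
    case False
    then show ?thesis unfolding form by simp
  qed (use pos form in auto)
  show "0 < bform (\<lambda>i j. K (p i) (p j)) n c c" if inj: "inj_on p {..<n}" and nz: "\<exists>i<n. c i \<noteq> 0"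
  proof -
    obtain i where i: "i < n" "c i \<noteq> 0" using nz by blast
    have "{j. j \<in> {..<n} \<and> p j = p i} = {i}" using inj i(1) by (auto dest: inj_onD)
    then have "C (p i) = c i" by (simp add: C_def)
    then show ?thesis unfolding form using i by (intro pos bexI[of _ "p i"]) (auto simp: S_def)
  qed
qed

lemma compact_lipschitz_domain_imp_compact:
  assumes "compact_lipschitz_domain d X"
  shows "compact X"
proof -
  have "compactin (product_topology (\<lambda>_. euclideanreal) (UNIV :: nat set)) X"
    using assms by (simp add: compact_lipschitz_domain_def Euclidean_space_def compactin_subtopology)
  then show ?thesis by (simp add: euclidean_product_topology compactin_euclidean_iff)
qed

lemma bounded_psd_kernel_on_domain:
  fixes X :: "point set"
  assumes "compact X" and adm: "admissible_kernel X K" and "prob_space \<rho>"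
    and sets: "sets \<rho> = sets (restrict_space borel X)"
  shows "bounded_psd_kernel \<rho> K (kappa X K)"
proof -
  interpret prob_space \<rho> by fact
  have sp: "space \<rho> = X" using sets_eq_imp_space_eq[OF sets] by (simp add: space_restrict_space)
  have cont: "continuous_on (X \<times> X) (\<lambda>(x, y). K x y)"
    and sym: "\<And>x y. x \<in> X \<Longrightarrow> y \<in> X \<Longrightarrow> K x y = K y x"
    and spd: "strictly_pos_def_on X K"
    using adm by (auto simp: admissible_kernel_def)
  have id: "(\<lambda>x. x) \<in> measurable \<rho> borel"
    using measurable_restrict_space1[of "\<lambda>x. x" borel borel X] measurable_cong_sets[OF sets refl] by auto
  have "(\<lambda>z. z) \<in> measurable (\<rho> \<Otimes>\<^sub>M \<rho>) (borel :: (point \<times> point) measure)"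
  proof -
    have "(\<lambda>z. (fst z, snd z)) \<in> measurable (\<rho> \<Otimes>\<^sub>M \<rho>) (borel \<Otimes>\<^sub>M borel)"
      using measurable_compose[OF measurable_fst id] measurable_compose[OF measurable_snd id]
      by (intro measurable_Pair) auto
    then show ?thesis by (simp add: borel_prod)
  qed
  then have "(\<lambda>z. z) \<in> measurable (\<rho> \<Otimes>\<^sub>M \<rho>) (restrict_space borel (X \<times> X))"
    by (intro measurable_restrict_space2) (auto simp: space_pair_measure sp)
  from measurable_compose[OF this borel_measurable_continuous_on_restrict[OF cont]]
  have meas: "(\<lambda>(x, y). K x y) \<in> borel_measurable (\<rho> \<Otimes>\<^sub>M \<rho>)" .
  have "compact ((\<lambda>(x, y). K x y) ` (X \<times> X))"
    using cont \<open>compact X\<close> by (intro compact_continuous_image compact_Times)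
  then have "bdd_above ((\<lambda>p. K (fst p) (snd p)) ` (X \<times> X))"
    by (simp add: case_prod_beta' compact_imp_bounded bounded_imp_bdd_above)
  then have K_le: "K x x \<le> (SUP p \<in> X \<times> X. K (fst p) (snd p))" if "x \<in> X" for x
    using cSUP_upper[of "(x, x)" "X \<times> X" "\<lambda>p. K (fst p) (snd p)"] that by simp
  have K_nonneg: "0 \<le> K x x" if "x \<in> X" for x
    using strictly_pos_def_sequence(1)[OF spd, of "\<lambda>_. x" 1 "\<lambda>_. 1"] that by (auto simp: bform_def)
  obtain x0 where "x0 \<in> X" using not_empty sp by blast
  then have "0 \<le> (SUP p \<in> X \<times> X. K (fst p) (snd p))"
    using K_le K_nonneg order_trans by blast
  then have kap: "(kappa X K)\<^sup>2 = (SUP p \<in> X \<times> X. K (fst p) (snd p))" "0 \<le> kappa X K"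
    by (simp_all add: kappa_def)
  show ?thesis
    by unfold_locales
      (use meas sym K_le kap strictly_pos_def_sequence(1)[OF spd] in \<open>auto simp: sp\<close>)
qed

theorem theorem3p3:
  shows "\<exists>C3 :: real \<Rightarrow> real \<Rightarrow> real \<Rightarrow> real \<Rightarrow> real.
    \<forall>(d::nat) (X :: point set) (K :: point \<Rightarrow> point \<Rightarrow> real) (\<rho> :: point measure)
      (m::nat) (\<delta>::real) (r::real) (fstar :: point \<Rightarrow> real) (hstar :: point \<Rightarrow> real).
      compact_lipschitz_domain d X \<and>
      admissible_kernel X K \<and>
      prob_space \<rho> \<and> sets \<rho> = sets (restrict_space borel X) \<and>
      1 \<le> m \<and>
      (AE \<omega> in Pi\<^sub>M {..<m} (\<lambda>_. \<rho>). inj_on \<omega> {..<m}) \<and>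
      0 < \<delta> \<and> \<delta> < 1 \<and>
      0 < r \<and> r < 1 / 2 \<and>
      continuous_on X fstar \<and>
      hstar \<in> L2_space \<rho> \<and>
      is_kernel_op_power \<rho> K r hstar fstar
      \<longrightarrow>
      (\<exists>E \<in> sets (Pi\<^sub>M {..<m} (\<lambda>_. \<rho>)).
        measure (Pi\<^sub>M {..<m} (\<lambda>_. \<rho>)) E \<ge> 1 - \<delta> \<and>
        (\<forall>x \<in> E. \<forall>y :: nat \<Rightarrow> real. (\<forall>i<m. y i = fstar (x i)) \<longrightarrow>
          L2_norm \<rho> (\<lambda>t. fstar t - interpolant K m x y t)
          \<le> C3 (kappa X K) (L2_norm \<rho> hstar) (sup_norm_on X fstar) r * (ln (24 / \<delta>)) ^ 6 *
            (INF lam \<in> {0<..}.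
              (1 + (1 + lam * real m * inverse (gram_eig K m x (m - 1))) *
                   (A_quantity K m x lam + 1) powr (2 * r + 2)) * lam powr r +
              ((1 + lam * real m * inverse (gram_eig K m x (m - 1))) + lam powr (r - 1 / 2)) *
                (A_quantity K m x lam + 1)\<^sup>2 * sqrt lam * A_quantity K m x lam)))"
proof -
  define C3 :: "real \<Rightarrow> real \<Rightarrow> real \<Rightarrow> real \<Rightarrow> real"
    where "C3 = (\<lambda>\<kappa> H B r. 2 * \<kappa> * (4 + 3 * H + B + 2 * \<kappa> * H))"
  show ?thesis
  proof (rule exI[of _ C3], intro allI impI, elim conjE)
    fix d X K and \<rho> :: "point measure" and m :: nat and \<delta> r :: real and f h :: "point \<Rightarrow> real"
    assume dom: "compact_lipschitz_domain d X" and adm: "admissible_kernel X K"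
      and prob: "prob_space \<rho>" and sets: "sets \<rho> = sets (restrict_space borel X)"
      and m: "1 \<le> m" and AE_inj: "AE \<omega> in Pi\<^sub>M {..<m} (\<lambda>_. \<rho>). inj_on \<omega> {..<m}"
      and \<delta>: "0 < \<delta>" "\<delta> < 1" and r: "0 < r" "r < 1 / 2" and cont: "continuous_on X f"
      and pw: "is_kernel_op_power \<rho> K r h f"
    define P where "P = Pi\<^sub>M {..<m} (\<lambda>_. \<rho>)"
    have "compact X" using dom by (rule compact_lipschitz_domain_imp_compact)
    interpret bounded_psd_kernel \<rho> K "kappa X K"
      by (rule bounded_psd_kernel_on_domain[OF \<open>compact X\<close> adm prob sets])
    interpret P: finite_product_prob_space "\<lambda>_. \<rho>" "{..<m}" by unfold_locales auto
    have sp: "space \<rho> = X" using sets_eq_imp_space_eq[OF sets] by (simp add: space_restrict_space)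
    have spd: "strictly_pos_def_on X K" using adm by (simp add: admissible_kernel_def)
    have "compact ((\<lambda>x. \<bar>f x\<bar>) ` X)"
      using cont \<open>compact X\<close> by (intro compact_continuous_image continuous_on_rabs)
    then have "bdd_above ((\<lambda>x. \<bar>f x\<bar>) ` X)"
      by (simp add: compact_imp_bounded bounded_imp_bdd_above)
    then have f_bound: "\<bar>f x\<bar> \<le> sup_norm_on X f" if "x \<in> space \<rho>" for x
      unfolding sup_norm_on_def using that by (intro cSUP_upper) (auto simp: sp)
    have pd: "0 < bform (\<lambda>i j. K (xs i) (xs j)) m u u"
      if "xs ` {..<m} \<subseteq> space \<rho>" "inj_on xs {..<m}" "\<exists>i<m. u i \<noteq> 0" for xs u
      using strictly_pos_def_sequence(2)[OF spd] that by (simp add: sp)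
    define C where "C = C3 (kappa X K) (L2_norm \<rho> h) (sup_norm_on X f) r"
    obtain E where E: "E \<in> sets P" "1 - \<delta> \<le> measure P E"
      and err: "\<forall>xs\<in>E. \<forall>y. inj_on xs {..<m} \<longrightarrow> (\<forall>i<m. y i = f (xs i)) \<longrightarrow>
        L2_norm \<rho> (\<lambda>t. f t - interpolant K m xs y t) \<le> C * ln (24 / \<delta>) *
          (sqrt (real m / gram_eig K m xs (m - 1)) * real m powr (- r))"
      using interpolation_error_high_probability[OF pw r m \<delta> f_bound pd]
      unfolding P_def C_def C3_def by blast
    \<comment> \<open>Samples with repeated points, for which the Gram matrix is singular, form a null set and are removed.\<close>
    obtain N where N: "{\<omega> \<in> space P. \<not> inj_on \<omega> {..<m}} \<subseteq> N" "N \<in> null_sets P"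
      using AE_inj unfolding P_def[symmetric] eventually_ae_filter by auto
    have EN: "E - N \<in> sets P" "1 - \<delta> \<le> measure P (E - N)"
      using E N(2) by (auto simp: measure_Diff_null_set)
    show "\<exists>E \<in> sets (Pi\<^sub>M {..<m} (\<lambda>_. \<rho>)).
        measure (Pi\<^sub>M {..<m} (\<lambda>_. \<rho>)) E \<ge> 1 - \<delta> \<and>
        (\<forall>x \<in> E. \<forall>y :: nat \<Rightarrow> real. (\<forall>i<m. y i = f (x i)) \<longrightarrow>
          L2_norm \<rho> (\<lambda>t. f t - interpolant K m x y t)
          \<le> C3 (kappa X K) (L2_norm \<rho> h) (sup_norm_on X f) r * (ln (24 / \<delta>)) ^ 6 *
            (INF lam \<in> {0<..}.
              (1 + (1 + lam * real m * inverse (gram_eig K m x (m - 1))) *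
                   (A_quantity K m x lam + 1) powr (2 * r + 2)) * lam powr r +
              ((1 + lam * real m * inverse (gram_eig K m x (m - 1))) + lam powr (r - 1 / 2)) *
                (A_quantity K m x lam + 1)\<^sup>2 * sqrt lam * A_quantity K m x lam))"
      unfolding P_def[symmetric] C_def[symmetric]
    proof (intro bexI[of _ "E - N"] conjI ballI allI impI EN)
      fix xs y assume xsE: "xs \<in> E - N" and y: "\<forall>i<m. y i = f (xs i)"
      have "xs \<in> space P" using xsE sets.sets_into_space[OF E(1)] by blast
      then have xs: "xs ` {..<m} \<subseteq> space \<rho>" by (auto simp: P_def space_PiM PiE_def Pi_def)
      have inj: "inj_on xs {..<m}" using xsE N(1) \<open>xs \<in> space P\<close> by blast
      have "0 < m" using m by simp
      define \<sigma> where "\<sigma> = gram_eig K m xs (m - 1)"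
      have \<sigma>: "0 < \<sigma>" unfolding \<sigma>_def by (rule smallest_eig_bounds(1)[OF xs \<open>0 < m\<close> pd[OF xs inj]])
      have \<sigma>_min: "\<sigma> \<le> gram_eig K m xs l" if "l < m" for l
        unfolding \<sigma>_def using xs \<open>0 < m\<close> that by (intro gram_smallest_eig(1) K_sym) auto
      define \<theta> where "\<theta> = sqrt (real m / \<sigma>) * real m powr (- r)"
      let ?R = "\<lambda>lam. (1 + (1 + lam * real m * inverse \<sigma>) *
                   (A_quantity K m xs lam + 1) powr (2 * r + 2)) * lam powr r +
              ((1 + lam * real m * inverse \<sigma>) + lam powr (r - 1 / 2)) *
                (A_quantity K m xs lam + 1)\<^sup>2 * sqrt lam * A_quantity K m xs lam"
      have "0 \<le> \<theta>" using \<sigma> by (simp add: \<theta>_def)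
      have "\<theta> \<le> (INF lam\<in>{0<..}. ?R lam)"
      proof (rule cINF_greatest)
        fix lam :: real assume "lam \<in> {0<..}"
        then have "2 * \<theta> \<le> ?R lam"
          using error_bound_ge[OF m _ r(1) \<sigma> \<sigma>_min, of lam] by (simp add: \<theta>_def mult.assoc)
        then show "\<theta> \<le> ?R lam" using \<open>0 \<le> \<theta>\<close> by linarith
      qed auto
      have l1: "1 \<le> ln (24 / \<delta>)" using \<delta> by (rule ln_24_div_ge_1)
      have "0 \<le> \<bar>f (xs 0)\<bar>" by simp
      also have "\<dots> \<le> sup_norm_on X f" using xs \<open>0 < m\<close> by (intro f_bound) auto
      finally have "0 \<le> C"
        unfolding C_def C3_def using \<kappa>_nonneg by (auto simp: L2_norm_def L2_inner_self intro!: mult_nonneg_nonneg add_nonneg_nonneg)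
      have "L2_norm \<rho> (\<lambda>t. f t - interpolant K m xs y t) \<le> C * ln (24 / \<delta>) * \<theta>"
        using err xsE inj y by (simp add: \<theta>_def \<sigma>_def)
      also have "\<dots> \<le> C * ln (24 / \<delta>) ^ 6 * (INF lam\<in>{0<..}. ?R lam)"
      proof (intro mult_mono mult_left_mono \<open>0 \<le> C\<close> \<open>0 \<le> \<theta>\<close> \<open>\<theta> \<le> _\<close>)
        show "ln (24 / \<delta>) \<le> ln (24 / \<delta>) ^ 6" using l1 by (intro self_le_power) auto
      qed (use \<open>0 \<le> C\<close> l1 in auto)
      finally show "L2_norm \<rho> (\<lambda>t. f t - interpolant K m xs y t) \<le> C * ln (24 / \<delta>) ^ 6 *
          (INF lam\<in>{0<..}. (1 + (1 + lam * real m * inverse (gram_eig K m xs (m - 1))) *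
                   (A_quantity K m xs lam + 1) powr (2 * r + 2)) * lam powr r +
              ((1 + lam * real m * inverse (gram_eig K m xs (m - 1))) + lam powr (r - 1 / 2)) *
                (A_quantity K m xs lam + 1)\<^sup>2 * sqrt lam * A_quantity K m xs lam)"
        unfolding \<sigma>_def .
    qed
  qed
qed

end
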